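(* Let $G$ be a finite graph that is a Sidorenko graph, i.e. $t(G,H)\geq t(e,H)^{|E(G)|}$ holds for every finite graph $H$, where $e$ denotes the single edge. Then for every $x\in(-1,1)$ $$\tau(G,x)\geq (1-x^2)^{|E(G)|}.$$
   Context: Graphs are finite and simple. For finite graphs $G$ and $H$, $t(G,H)$ denotes the probability that a uniformly random map $V(G)\to V(H)$ takes every edge of $G$ to an edge of $H$; $e$ is the graph consisting of two vertices joined by an edge. (A Sidorenko graph is automatically bipartite, as one sees by taking $H=e$.) For a finite graph $G=(V,E)$ and $x\in(-1,1)$, $\Psi(G,x)$ is the set of real $V\times V$ matrices $M$ such that (1) $M$ is (symmetric) positive definite, (2) every diagonal entry of $M$ is $1$, (3) $M_{i,j}=x$ for every edge $(i,j)$ of $G$. When $\Psi(G,x)$ is nonempty (which is always the case for bipartite $G$), there is a unique matrix $\Sigma(G,x)\in\Psi(G,x)$ maximizing the determinant on $\Psi(G,x)$, and $\tau(G,x):=\det(\Sigma(G,x))$. *)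

theory Defs
  imports "HOL-Probability.Probability"
begin

text \<open>A graph is given by its vertex set and its set of edges, an edge being a two-element set
  of vertices.\<close>

definition simple_graph :: "'a set \<Rightarrow> 'a set set \<Rightarrow> bool" where
  "simple_graph V E \<longleftrightarrow> finite V \<and> (\<forall>e\<in>E. e \<subseteq> V \<and> card e = 2)"

text \<open>\<open>hom_density V E W F\<close> is $t(G,H)$ for $G = (V,E)$ and $H = (W,F)$. A map that identifies the
  two ends of an edge sends that edge to a singleton, which is never an edge of \<open>H\<close>. The value is
  meaningful only for nonempty \<open>W\<close>.\<close>

definition hom_density :: "'a set \<Rightarrow> 'a set set \<Rightarrow> 'b set \<Rightarrow> 'b set set \<Rightarrow> real" where
  "hom_density V E W F =
     measure_pmf.prob (pmf_of_set (V \<rightarrow>\<^sub>E W)) {f. \<forall>e\<in>E. f ` e \<in> F}"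

abbreviation edge_density :: "'b set \<Rightarrow> 'b set set \<Rightarrow> real" where
  "edge_density W F \<equiv> hom_density {0, 1::nat} {{0, 1}} W F"

text \<open>The target graphs range over the finite graphs on natural numbers, which represent all finite
  graphs up to isomorphism. Without vertices in the target there is no uniformly random map,
  hence \<open>W \<noteq> {}\<close>.\<close>

definition sidorenko :: "'a set \<Rightarrow> 'a set set \<Rightarrow> bool" where
  "sidorenko V E \<longleftrightarrow>
     (\<forall>(W::nat set) F. simple_graph W F \<and> W \<noteq> {} \<longrightarrow>
        hom_density V E W F \<ge> edge_density W F ^ card E)"

definition pos_def :: "real^'n^'n \<Rightarrow> bool" where
  "pos_def M \<longleftrightarrow> transpose M = M \<and> (\<forall>v. v \<noteq> 0 \<longrightarrow> v \<bullet> (M *v v) > 0)"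

text \<open>From here on the vertex set of the graph is the whole (finite) type \<open>'v\<close>, so that
  \<open>V \<times> V\<close> matrices are elements of \<open>real^'v^'v\<close>.\<close>

definition Psi :: "'v::finite set set \<Rightarrow> real \<Rightarrow> (real^'v^'v) set" where
  "Psi E x = {M. pos_def M \<and> (\<forall>i. M $ i $ i = 1) \<and> (\<forall>i j. {i, j} \<in> E \<longrightarrow> M $ i $ j = x)}"

definition Sigma_mat :: "'v::finite set set \<Rightarrow> real \<Rightarrow> real^'v^'v" where
  "Sigma_mat E x = (THE M. is_arg_max det (\<lambda>M. M \<in> Psi E x) M)"

definition tau :: "'v::finite set set \<Rightarrow> real \<Rightarrow> real" where
  "tau E x = det (Sigma_mat E x)"

end

theory Submission imports Defs begin

text \<open>
The theorem is a large deviation statement about the Sidorenko inequality in one special graph. Take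
independent standard Gaussian vectors in dimension \<open>n\<close> as vertices, two of them being
adjacent if their Gram matrix is close to $n$ times the matrix with unit diagonal and entry
\<open>x\<close> off the diagonal. For random vectors indexed by a finite set $V$, the probability
that their Gram matrix is close to $n M$ is $\det(M)^{n/2}$ to exponential order. Hence the edge
density of this graph is about $(1-x^2)^{n/2}$. A homomorphism from $G$ leaves the entries of the
Gram matrix at pairs that are not edges free, so its probability is governed by the best choice of
these entries, which gives $\tau(G,x)^{n/2}$. The Sidorenko inequality for the densities, after the
$n$-th root, is the claim.

The proof combines two exponential bounds. The upper bound for the density of $G$
(\<open>graph_density_upper_bound\<close>) is Chernoff's bound with the exponent $K - I$, where $K$
is the inverse of the determinant maximizer. It works because $K$ vanishes at pairs that are not
edges (\<open>tau_dual_matrix\<close>), so that $\mathrm{tr}(KS)$ is known as soon as $S$ has the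
prescribed entries, and because the Laplace transform of the Gaussian law at this exponent is
exactly $\det(K)^{-1/2}$ (\<open>laplace_transform_std_gauss\<close>). The lower bound for the edge
density (\<open>edge_density_lower_bound\<close>) is a change of measure to pairs with correlation
\<open>x\<close>, for which adjacency is typical.

The Sidorenko property speaks of finite graphs. It extends to the infinite graph by sampling: the
expected densities in the graph on $N$ random points converge, and Jensen's inequality takes care of
the power (\<open>sidorenko_kernel\<close>). Finally \<open>Psi\<close> is nonempty because a
Sidorenko graph is bipartite (\<open>Psi_nonempty_of_sidorenko\<close>).
\<close>

section \<open>Positive definite matrices and elimination\<close>

definition quad_form :: "real^'n^'n \<Rightarrow> real^'n \<Rightarrow> real" where
  "quad_form M v = v \<bullet> (M *v v)"

lemma quad_form_sum: "quad_form M v = (\<Sum>i\<in>UNIV. \<Sum>j\<in>UNIV. M $ i $ j * (v $ i * v $ j))"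
  unfolding quad_form_def inner_vec_def inner_real_def matrix_vector_mult_def vec_lambda_beta
    sum_distrib_left
  by (intro sum.cong refl) (rule mult.left_commute)

lemma quad_form_congruence: "quad_form (transpose E ** M ** E) v = quad_form M (E *v v)"
proof -
  have "v \<bullet> (transpose E *v w) = (E *v v) \<bullet> w" for w
    using dot_lmul_matrix[of v "transpose E" w] by simp
  then show ?thesis
    by (simp add: quad_form_def matrix_vector_mul_assoc[symmetric] matrix_mul_assoc[symmetric])
qed

lemma pos_def_quad_form:
  "pos_def M \<longleftrightarrow> transpose M = M \<and> (\<forall>v. v \<noteq> 0 \<longrightarrow> quad_form M v > 0)"
  by (simp add: pos_def_def quad_form_def)

lemma pos_def_sym:
  assumes "pos_def M"
  shows "M $ i $ j = M $ j $ i"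
proof -
  have "transpose M $ i $ j = M $ i $ j" using assms by (simp add: pos_def_def)
  then show ?thesis by (simp add: transpose_def)
qed

lemma pos_def_diag_pos:
  fixes M :: "real^'n^'n"
  assumes "pos_def M"
  shows "M $ i $ i > 0"
proof -
  note assms
  moreover have "axis i 1 \<noteq> (0::real^'n)" by (simp add: axis_eq_0_iff)
  ultimately have "axis i (1::real) \<bullet> (M *v axis i 1) > 0"
    by (simp add: pos_def_def)
  then show ?thesis
    by (simp add: inner_axis' matrix_vector_mult_basis column_def)
qed

lemma pos_def_congruence:
  assumes "pos_def M" "det E \<noteq> 0"
  shows "pos_def (transpose E ** M ** E)"
proof -
  have "E *v v \<noteq> 0" if "v \<noteq> 0" for v
    using assms(2) that by (metis invertible_det_nz matrix_left_invertible_ker invertible_def)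
  moreover have "transpose (transpose E ** M ** E) = transpose E ** M ** E"
    using assms(1) by (simp add: pos_def_def matrix_transpose_mul matrix_mul_assoc)
  ultimately show ?thesis
    using assms(1) by (simp add: pos_def_quad_form quad_form_congruence)
qed

text \<open>Row \<open>i\<close> of this matrix records the substitution that replaces coordinate
\<open>i\<close> of a vector by itself plus a combination of the other coordinates. These are the
steps of Gaussian elimination: they have determinant one and they preserve Lebesgue measure, so that
determinants and Gaussian integrals can be computed along one and the same elimination.\<close>
definition shear :: "'n \<Rightarrow> real^'n \<Rightarrow> real^'n^'n" where
  "shear i c = (\<chi> k l. of_bool (k = l) + (if k = i \<and> l \<noteq> i then c $ l else 0))"

lemma shear_mult:
  "(shear i c *v v) $ k = v $ k + (if k = i then (\<Sum>l\<in>UNIV-{i}. c $ l * v $ l) else 0)"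
proof -
  have "(shear i c *v v) $ k = (\<Sum>l\<in>UNIV. of_bool (k = l) * v $ l)
      + (\<Sum>l\<in>UNIV. if k = i \<and> l \<noteq> i then c $ l * v $ l else 0)"
    unfolding shear_def matrix_vector_mult_def vec_lambda_beta sum.distrib[symmetric]
    by (intro sum.cong) (auto simp: ring_distribs)
  also have "(\<Sum>l\<in>UNIV. of_bool (k = l) * v $ l) = v $ k"
    by (simp add: of_bool_def if_distrib if_distribR cong: if_cong)
  also have "(\<Sum>l\<in>UNIV. if k = i \<and> l \<noteq> i then c $ l * v $ l else 0)
      = (if k = i then (\<Sum>l\<in>UNIV-{i}. c $ l * v $ l) else 0)"
    by (auto intro!: sum.mono_neutral_cong_right split: if_splits)
  finally show ?thesis .
qed

lemma det_shear: "det (shear i c) = 1"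
proof -
  let ?x = "\<chi> l. if l \<noteq> i then c $ l else (0::real)"
  have "(\<Sum>j\<in>UNIV-{i}. (c $ j *s row j (mat 1)) $ l) = ?x $ l" for l
  proof -
    have "(\<Sum>j\<in>UNIV-{i}. (c $ j *s row j (mat 1)) $ l) = (\<Sum>j\<in>UNIV-{i}. if l = j then c $ j else 0)"
      by (intro sum.cong) (auto simp: row_def mat_def)
    then show ?thesis by simp
  qed
  then have "?x = (\<Sum>j\<in>UNIV-{i}. c $ j *s row j (mat 1))"
    by (simp add: vec_eq_iff)
  also have "\<dots> \<in> vec.span {row j (mat 1 :: real^'a^'a) | j. j \<noteq> i}"
    by (intro vec.span_sum vec.span_scale vec.span_base) blast
  finally have x: "?x \<in> vec.span {row j (mat 1 :: real^'a^'a) | j. j \<noteq> i}" .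
  have "shear i c = (\<chi> k. if k = i then row i (mat 1) + ?x else row k (mat 1))"
    by (auto simp: vec_eq_iff shear_def row_def mat_def)
  with det_row_span[OF x] show ?thesis by simp
qed

text \<open>Completing the square in the variable \<open>i\<close>: the cross terms with \<open>i\<close>
disappear, and the remaining block becomes the Schur complement of the pivot
\<open>K $ i $ i\<close>.\<close>
lemma shear_elimination:
  fixes K :: "real^'n^'n" and i :: 'n
  assumes "pos_def K"
  defines "E \<equiv> shear i (\<chi> j. - K $ i $ j / K $ i $ i)"
  shows "(transpose E ** K ** E) $ j $ k =
    (if j = i \<and> k = i then K $ i $ i else if j = i \<or> k = i then 0
     else K $ j $ k - K $ j $ i * K $ i $ k / K $ i $ i)"
proof -
  define c :: "real^'n" where "c = (\<chi> j. - K $ i $ j / K $ i $ i)"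
  have sym: "K $ a $ b = K $ b $ a" for a b using assms(1) by (rule pos_def_sym)
  have p: "K $ i $ i \<noteq> 0" using pos_def_diag_pos[OF assms(1), of i] by simp
  have E: "E $ a $ b = of_bool (a = b) + (if a = i \<and> b \<noteq> i then c $ b else 0)" for a b
    by (simp add: E_def shear_def c_def)
  have KE: "(K ** E) $ a $ b = K $ a $ b + (if b = i then 0 else K $ a $ i * c $ b)" for a b
  proof -
    have "(K ** E) $ a $ b = (\<Sum>l\<in>UNIV. if l = b then K $ a $ l else 0)
      + (\<Sum>l\<in>UNIV. if l = i then (if b = i then 0 else K $ a $ i * c $ b) else 0)"
      unfolding matrix_matrix_mult_def vec_lambda_beta sum.distrib[symmetric]
      by (intro sum.cong) (auto simp: E ring_distribs)
    then show ?thesis by simp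
  qed
  have "(transpose E ** K ** E) $ j $ k = (transpose E ** (K ** E)) $ j $ k"
    by (simp add: matrix_mul_assoc)
  also have "\<dots> = (\<Sum>l\<in>UNIV. if l = j then (K ** E) $ l $ k else 0)
      + (\<Sum>l\<in>UNIV. if l = i then (if j = i then 0 else c $ j * (K ** E) $ i $ k) else 0)"
    unfolding matrix_matrix_mult_def[of "transpose E"] vec_lambda_beta sum.distrib[symmetric]
    by (intro sum.cong) (auto simp: transpose_def E ring_distribs)
  also have "\<dots> = (K ** E) $ j $ k + (if j = i then 0 else c $ j * (K ** E) $ i $ k)"
    by simp
  finally show ?thesis
    using p by (auto simp: KE c_def sym[of i j] field_simps)
qed

inductive_set shears :: "(real^'n^'n) set" where
  one: "mat 1 \<in> shears"
| mult: "E \<in> shears \<Longrightarrow> E ** shear i c \<in> shears"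

lemma det_shears: "E \<in> shears \<Longrightarrow> det E = 1"
  by (induction rule: shears.induct) (simp_all add: det_mul det_shear)

text \<open>Coordinates are eliminated one at a time, and a coordinate that has been decoupled stays decoupled.
Every step subtracts a nonnegative number \<open>(K $ i $ k)\<^sup>2 / K $ i $ i\<close> from the
diagonal, which is what yields the Hadamard inequality below.\<close>
lemma diagonalize_by_shears:
  assumes K: "pos_def K"
  obtains E where "E \<in> shears" "\<And>i j. i \<noteq> j \<Longrightarrow> (transpose E ** K ** E) $ i $ j = 0"
    "\<And>i. (transpose E ** K ** E) $ i $ i \<le> K $ i $ i"
proof -
  have "\<exists>E\<in>shears. (\<forall>i\<in>S. \<forall>j. i \<noteq> j \<longrightarrow> (transpose E ** K ** E) $ i $ j = 0) \<and>
    (\<forall>i. (transpose E ** K ** E) $ i $ i \<le> K $ i $ i)" if "finite S" for S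
    using that
  proof induction
    case empty
    show ?case by (rule bexI[of _ "mat 1"]) (auto simp: shears.one transpose_mat)
  next
    case (insert i S)
    then obtain E where E: "E \<in> shears"
      and z: "\<And>s j. s \<in> S \<Longrightarrow> s \<noteq> j \<Longrightarrow> (transpose E ** K ** E) $ s $ j = 0"
      and d: "\<And>k. (transpose E ** K ** E) $ k $ k \<le> K $ k $ k" by blast
    define K1 where "K1 = transpose E ** K ** E"
    have pd: "pos_def K1" unfolding K1_def
      using K det_shears[OF E] by (simp add: pos_def_congruence)
    define F where "F = shear i (\<chi> j. - K1 $ i $ j / K1 $ i $ i)"
    have eq: "transpose (E ** F) ** K ** (E ** F) = transpose F ** K1 ** F"
      by (simp add: K1_def matrix_transpose_mul matrix_mul_assoc)
    have el: "(transpose F ** K1 ** F) $ j $ k = (if j = i \<and> k = i then K1 $ i $ i else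
      if j = i \<or> k = i then 0 else K1 $ j $ k - K1 $ j $ i * K1 $ i $ k / K1 $ i $ i)" for j k
      unfolding F_def by (rule shear_elimination[OF pd])
    have "E ** F \<in> shears" unfolding F_def using E by (rule shears.mult)
    moreover have "(transpose F ** K1 ** F) $ s $ j = 0" if "s \<in> insert i S" "s \<noteq> j" for s j
      using that z[folded K1_def] by (auto simp: el)
    moreover have "(transpose F ** K1 ** F) $ k $ k \<le> K $ k $ k" for k
    proof -
      have "K1 $ k $ i * K1 $ i $ k / K1 $ i $ i \<ge> 0"
        using pos_def_diag_pos[OF pd, of i] pos_def_sym[OF pd, of k i] by simp
      then show ?thesis using d[of k, folded K1_def] by (auto simp: el)
    qed
    ultimately show ?case by (intro bexI[of _ "E ** F"]) (auto simp: eq)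
  qed
  from this[of UNIV] that show thesis by auto
qed

lemma det_congruence_shears:
  "E \<in> shears \<Longrightarrow> det (transpose E ** K ** E) = det K"
  by (simp add: det_mul det_shears)

lemma hadamard_inequality:
  fixes K :: "real^'n^'n"
  assumes K: "pos_def K"
  shows "0 < det K" "det K \<le> (\<Prod>i\<in>UNIV. K $ i $ i)"
proof -
  obtain E where E: "E \<in> shears" "\<And>i j. i \<noteq> j \<Longrightarrow> (transpose E ** K ** E) $ i $ j = 0"
    "\<And>i. (transpose E ** K ** E) $ i $ i \<le> K $ i $ i"
    using diagonalize_by_shears[OF K] by blast
  let ?D = "transpose E ** K ** E"
  have pd: "pos_def ?D" using K det_shears[OF E(1)] by (simp add: pos_def_congruence)
  have det: "det K = (\<Prod>i\<in>UNIV. ?D $ i $ i)"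
    using det_congruence_shears[OF E(1), of K] det_diagonal[of ?D] E(2) by simp
  show "0 < det K" unfolding det by (intro prod_pos) (simp add: pos_def_diag_pos[OF pd])
  show "det K \<le> (\<Prod>i\<in>UNIV. K $ i $ i)" unfolding det
    by (intro prod_mono) (auto simp: E(3) less_imp_le[OF pos_def_diag_pos[OF pd]])
qed

text \<open>If an entry off the diagonal is nonzero, then a single elimination step already makes a diagonal
entry strictly smaller without changing the determinant, and the inequality applied to the new
matrix is strict for the old one.\<close>
lemma hadamard_equality:
  fixes K :: "real^'n^'n"
  assumes K: "pos_def K" and eq: "det K = (\<Prod>i\<in>UNIV. K $ i $ i)" and ij: "i \<noteq> j"
  shows "K $ i $ j = 0"
proof (rule ccontr)
  assume nz: "K $ i $ j \<noteq> 0"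
  define F where "F = shear i (\<chi> j. - K $ i $ j / K $ i $ i)"
  let ?K = "transpose F ** K ** F"
  note el = shear_elimination[OF K, of i, folded F_def]
  have F: "det F = 1" by (simp add: F_def det_shear)
  have pd: "pos_def ?K" using K F by (simp add: pos_def_congruence)
  have nn: "K $ k $ i * K $ i $ k / K $ i $ i \<ge> 0" for k
    using pos_def_diag_pos[OF K, of i] pos_def_sym[OF K, of k i] by simp
  have "K $ j $ i * K $ i $ j / K $ i $ i > 0"
    using pos_def_diag_pos[OF K, of i] pos_def_sym[OF K, of j i] nz
    by (simp add: zero_less_mult_iff zero_less_divide_iff) linarith
  then have less: "?K $ j $ j < K $ j $ j" using ij by (simp add: el)
  have "det K = det ?K" by (simp add: det_mul F)
  also have "\<dots> \<le> (\<Prod>k\<in>UNIV. ?K $ k $ k)" by (rule hadamard_inequality(2)[OF pd])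
  also have "\<dots> < (\<Prod>k\<in>UNIV. K $ k $ k)"
  proof (rule prod_mono_strict)
    show "0 \<le> ?K $ k $ k \<and> ?K $ k $ k \<le> K $ k $ k" for k
      using nn[of k] pos_def_diag_pos[OF pd, of k] by (auto simp: el split: if_splits)
  qed (use less pos_def_diag_pos[OF K] in auto)
  finally show False using eq by simp
qed

text \<open>The equality case of the arithmetic-geometric mean inequality for the eigenvalues of
\<open>K ** N\<close>. Diagonalizing \<open>K\<close> by shears turns the hypotheses into
$\prod_i d_i n_i \geq 1$ and $\sum_i (d_i n_i - 1) = 0$ for the diagonal entries, so that
$t \leq \exp(t-1)$ is an equality for each $t = d_i n_i$ and Hadamard's inequality is one for the
transformed \<open>N\<close>. It is used to see that the maximizer of the determinant is unique.\<close>
lemma mult_eq_one_if_det_trace: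
  fixes K N :: "real^'n^'n"
  assumes K: "pos_def K" and N: "pos_def N"
    and eq: "det K * det N = 1" "trace (K ** N) = real CARD('n)"
  shows "K ** N = mat 1"
proof -
  obtain E where E: "E \<in> shears" "\<And>i j. i \<noteq> j \<Longrightarrow> (transpose E ** K ** E) $ i $ j = 0"
    "\<And>i. (transpose E ** K ** E) $ i $ i \<le> K $ i $ i"
    using diagonalize_by_shears[OF K] by blast
  define D where "D = transpose E ** K ** E"
  have dE: "det E = 1" using E(1) by (rule det_shears)
  then obtain G where G: "E ** G = mat 1" "G ** E = mat 1"
    using invertible_det_nz[of E] by (auto simp: invertible_def)
  have "det E * det G = 1" using det_mul[of E G] by (simp add: G)
  then have dG: "det G = 1" using dE by simp
  have G': "transpose G ** transpose E = mat 1" "transpose E ** transpose G = mat 1"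
    by (simp_all add: matrix_transpose_mul[symmetric] G transpose_mat)
  define N' where "N' = G ** N ** transpose G"
  have pdD: "pos_def D" unfolding D_def using K dE by (simp add: pos_def_congruence)
  have pdN: "pos_def N'" unfolding N'_def
    using pos_def_congruence[OF N, of "transpose G"] dG by simp
  have KN: "K ** N = transpose G ** (D ** N') ** transpose E"
  proof -
    have "transpose G ** (D ** N') ** transpose E
      = (transpose G ** transpose E) ** K ** (E ** G) ** N ** (transpose G ** transpose E)"
      by (simp add: D_def N'_def matrix_mul_assoc)
    then show ?thesis by (simp add: G G')
  qed
  have DN: "(D ** N') $ i $ j = D $ i $ i * N' $ i $ j" for i j
  proof -
    have "(D ** N') $ i $ j = (\<Sum>k\<in>UNIV. if k = i then D $ i $ i * N' $ i $ j else 0)"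
      unfolding matrix_matrix_mult_def vec_lambda_beta
      using E(2)[folded D_def] by (intro sum.cong) auto
    then show ?thesis by simp
  qed
  have "trace (K ** N) = trace (D ** N' ** transpose E ** transpose G)"
    unfolding KN by (metis matrix_mul_assoc trace_mul_sym)
  also have "\<dots> = (\<Sum>i\<in>UNIV. D $ i $ i * N' $ i $ i)"
    by (simp add: matrix_mul_assoc[symmetric] G') (simp add: trace_def DN)
  finally have tr: "trace (K ** N) = (\<Sum>i\<in>UNIV. D $ i $ i * N' $ i $ i)" .
  have detD: "det K = (\<Prod>i\<in>UNIV. D $ i $ i)"
    using det_congruence_shears[OF E(1), of K] det_diagonal[of D] E(2) by (simp add: D_def)
  have detN: "det N = det N'" by (simp add: N'_def det_mul dG)
  have Dpos: "0 < D $ i $ i" and Npos: "0 < N' $ i $ i" for i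
    using pdD pdN by (auto intro: pos_def_diag_pos)
  have Dpp: "0 < (\<Prod>i\<in>UNIV. D $ i $ i)" by (intro prod_pos) (simp add: Dpos)
  have one: "det K * det N \<le> (\<Prod>i\<in>UNIV. D $ i $ i * N' $ i $ i)"
    unfolding detD detN prod.distrib using hadamard_inequality(2)[OF pdN] Dpp by simp
  have expn: "exp (trace (K ** N) - real CARD('n)) = (\<Prod>i\<in>UNIV. exp (D $ i $ i * N' $ i $ i - 1))"
    by (simp add: tr exp_sum[symmetric] sum_subtractf)
  have ex: "D $ i $ i * N' $ i $ i \<le> exp (D $ i $ i * N' $ i $ i - 1)" for i
    using exp_ge_add_one_self[of "D $ i $ i * N' $ i $ i - 1"] by simp
  have e1: "(\<Prod>i\<in>UNIV. exp (D $ i $ i * N' $ i $ i - 1)) = 1" using expn eq(2) by simp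
  have d1: "D $ i $ i * N' $ i $ i = 1" for i
  proof (rule ccontr)
    assume ne: "D $ i $ i * N' $ i $ i \<noteq> 1"
    have pos: "0 < D $ i $ i * N' $ i $ i" using Dpos Npos by simp
    then have "ln (D $ i $ i * N' $ i $ i) < D $ i $ i * N' $ i $ i - 1"
      using ne ln_eq_minus_one[OF pos] ln_le_minus_one[OF pos] by linarith
    then have "exp (ln (D $ i $ i * N' $ i $ i)) < exp (D $ i $ i * N' $ i $ i - 1)"
      by (simp only: exp_less_cancel_iff)
    then have "D $ i $ i * N' $ i $ i < exp (D $ i $ i * N' $ i $ i - 1)"
      using pos by simp
    then have "(\<Prod>i\<in>UNIV. D $ i $ i * N' $ i $ i) < (\<Prod>i\<in>UNIV. exp (D $ i $ i * N' $ i $ i - 1))"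
      using ex by (intro prod_mono_strict[of i]) (auto intro: less_imp_le[OF mult_pos_pos[OF Dpos Npos]])
    then show False using e1 one eq(1) by simp
  qed
  have "(\<Prod>i\<in>UNIV. D $ i $ i) * det N' = (\<Prod>i\<in>UNIV. D $ i $ i) * (\<Prod>i\<in>UNIV. N' $ i $ i)"
    using eq(1) by (simp add: detD[symmetric] detN prod.distrib[symmetric] d1) (simp add: detD prod.distrib[symmetric] d1)
  then have "det N' = (\<Prod>i\<in>UNIV. N' $ i $ i)" using Dpos by (simp add: less_imp_neq[OF Dpos, symmetric])
  then have N'0: "N' $ i $ j = 0" if "i \<noteq> j" for i j using hadamard_equality[OF pdN] that by blast
  have "D ** N' = mat 1"
    by (auto simp: vec_eq_iff DN mat_def d1 N'0)
  then show "K ** N = mat 1" unfolding KN by (simp add: G')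
qed

section \<open>The maximizer of the determinant and its inverse\<close>

text \<open>In the Leibniz formula a permutation other than the identity moves at least two points, so its term
is divisible by $t^2$ and only the product of the diagonal entries contributes.\<close>
lemma has_derivative_det_at_one:
  fixes A :: "real^'n^'n"
  shows "((\<lambda>t. det (mat 1 + t *\<^sub>R A)) has_field_derivative trace A) (at 0)"
proof -
  let ?U = "UNIV :: 'n set"
  let ?P = "{p. p permutes ?U}"
  let ?f = "\<lambda>p i t. (mat 1 + t *\<^sub>R A) $ i $ p i"
  let ?d = "\<lambda>p. \<Sum>i\<in>?U. A $ i $ p i * (\<Prod>j\<in>?U-{i}. ?f p j 0)"
  have "((\<lambda>t. \<Prod>i\<in>?U. ?f p i t) has_field_derivative ?d p) (at 0)" for p
    by (rule has_field_derivative_prod) (auto intro!: derivative_eq_intros)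
  then have "((\<lambda>t. \<Sum>p\<in>?P. of_int (sign p) * (\<Prod>i\<in>?U. ?f p i t)) has_field_derivative
      (\<Sum>p\<in>?P. of_int (sign p) * ?d p)) (at 0)"
    by (intro DERIV_sum DERIV_cmult)
  moreover have "of_int (sign p) * ?d p = (if p = id then trace A else 0)" if p: "p \<in> ?P" for p
  proof (cases "p = id")
    case True
    then show ?thesis by (simp add: trace_def mat_def)
  next
    case False
    have "(\<Prod>j\<in>?U-{i}. ?f p j 0) = 0" for i
    proof -
      obtain a where a: "p a \<noteq> a" using False by fastforce
      have "inj p" using p by (auto intro: permutes_inj)
      then have b: "p (p a) \<noteq> p a" using a by (simp add: inj_eq)
      obtain j where j: "j \<in> ?U-{i}" "p j \<noteq> j" using a b by (cases "a = i") auto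
      then have "?f p j 0 = 0" by (simp add: mat_def)
      then show ?thesis using j(1) by (intro prod_zero) (auto intro!: bexI[of _ j])
    qed
    then have "?d p = 0" by (intro sum.neutral ballI) (simp only: mult_zero_right)
    then show ?thesis using False by (simp only: if_False mult_zero_right)
  qed
  then have "(\<Sum>p\<in>?P. of_int (sign p) * ?d p) = (\<Sum>p\<in>?P. if p = id then trace A else 0)"
    by (intro sum.cong) auto
  then have "(\<Sum>p\<in>?P. of_int (sign p) * ?d p) = trace A"
    using permutes_id[of ?U] by (simp add: finite_permutations)
  ultimately show ?thesis by (simp add: det_def)
qed

lemma continuous_on_quad_form: "continuous_on A (\<lambda>v. quad_form M v)"
  unfolding quad_form_sum by (intro continuous_intros)

lemma quad_form_scaleR: "quad_form M (r *\<^sub>R v) = r\<^sup>2 * quad_form M v"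
  by (simp add: quad_form_def matrix_vector_mult_scaleR power2_eq_square)

lemma pos_def_coercive:
  fixes M :: "real^'n^'n"
  assumes "pos_def M"
  obtains c where "c > 0" "\<And>v. c * (norm v)\<^sup>2 \<le> quad_form M v"
proof -
  have "sphere (0::real^'n) 1 \<noteq> {}" by simp
  then obtain u where u: "u \<in> sphere (0::real^'n) 1"
    and min: "\<And>v. v \<in> sphere 0 1 \<Longrightarrow> quad_form M u \<le> quad_form M v"
    using continuous_attains_inf[OF compact_sphere _ continuous_on_quad_form, of 0 1 M] by blast
  show thesis
  proof
    have "u \<noteq> 0" using u by auto
    then show "quad_form M u > 0" using assms by (simp add: pos_def_quad_form)
    fix v :: "real^'n"
    show "quad_form M u * (norm v)\<^sup>2 \<le> quad_form M v"
    proof (cases "v = 0")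
      case True then show ?thesis by (simp add: quad_form_def)
    next
      case False
      have "quad_form M u \<le> quad_form M ((1 / norm v) *\<^sub>R v)"
        by (rule min) (simp add: False)
      then show ?thesis using False by (simp add: quad_form_scaleR power_divide field_simps)
    qed
  qed
qed

text \<open>Positive definiteness is an open condition: a form that is at least $c\,|v|^2$ absorbs a
perturbation of size below \<open>c\<close>.\<close>
lemma pos_def_perturb:
  fixes M B :: "real^'n^'n"
  assumes M: "pos_def M" and B: "transpose B = B"
  obtains d where "d > 0" "\<And>t. \<bar>t\<bar> < d \<Longrightarrow> pos_def (M + t *\<^sub>R B)"
proof -
  obtain c where c: "c > 0" "\<And>v. c * (norm v)\<^sup>2 \<le> quad_form M v"
    using pos_def_coercive[OF M] by blast
  obtain C where C: "C > 0" "\<And>v. norm (B *v v) \<le> C * norm v"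
    using linear_bounded_pos[OF matrix_vector_mul_linear[of B]] by (metis mult.commute)
  show thesis
  proof
    show "c / C > 0" using c C by simp
    fix t :: real assume t: "\<bar>t\<bar> < c / C"
    have "transpose (M + t *\<^sub>R B) = M + t *\<^sub>R B"
      using M B by (simp add: pos_def_def transpose_def vec_eq_iff)
    moreover have "quad_form (M + t *\<^sub>R B) v > 0" if v: "v \<noteq> 0" for v
    proof -
      have "\<bar>quad_form B v\<bar> \<le> norm v * (C * norm v)"
        unfolding quad_form_def
        by (rule order_trans[OF Cauchy_Schwarz_ineq2]) (intro mult_left_mono C(2) norm_ge_zero)
      then have "\<bar>t\<bar> * \<bar>quad_form B v\<bar> \<le> \<bar>t\<bar> * (norm v * (C * norm v))"
        by (intro mult_left_mono) auto
      then have "\<bar>t * quad_form B v\<bar> \<le> \<bar>t\<bar> * (C * (norm v)\<^sup>2)"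
        by (simp add: abs_mult power2_eq_square mult.left_commute)
      also have "\<dots> < c * (norm v)\<^sup>2" using t v C(1) by (simp add: field_simps)
      also have "\<dots> \<le> quad_form M v" by (rule c)
      finally have "0 < quad_form M v + t * quad_form B v" by linarith
      also have "\<dots> = quad_form (M + t *\<^sub>R B) v"
        by (simp add: quad_form_def matrix_vector_mult_add_rdistrib inner_add_right
            scaleR_matrix_vector_assoc[symmetric])
      finally show ?thesis .
    qed
    ultimately show "pos_def (M + t *\<^sub>R B)" by (simp add: pos_def_quad_form)
  qed
qed

lemma pos_def_inverse:
  assumes M: "pos_def M"
  obtains K where "pos_def K" "K ** M = mat 1" "M ** K = mat 1" "det K * det M = 1"
proof -
  have "det M \<noteq> 0" using hadamard_inequality(1)[OF M] by simp
  then obtain K where K: "M ** K = mat 1" "K ** M = mat 1"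
    using invertible_det_nz[of M] by (auto simp: invertible_def)
  have det: "det K * det M = 1" using det_mul[of K M] K by simp
  have "transpose K ** M = mat 1"
    using matrix_transpose_mul[of M K] K M by (simp add: pos_def_def transpose_mat)
  then have "transpose K ** M ** K = K" by simp
  moreover have "pos_def (transpose K ** M ** K)"
    using det by (intro pos_def_congruence M) auto
  ultimately show thesis using that[of K] K det by simp
qed

text \<open>The entry \<open>M $ i $ j\<close> at a pair that is not an edge can be varied freely, and the
derivative of the determinant in this direction is \<open>det M * 2 * K $ i $ j\<close> for
\<open>K = M\<inverse>\<close>. So the inverse of a maximizer is supported on the diagonal and the
edges, that is, on the entries where \<open>Psi\<close> prescribes the values of the matrix.\<close>
lemma inverse_of_maximizer_vanishes:
  fixes M :: "real^'v^'v"
  assumes M: "M \<in> Psi E x" and max: "\<And>N. N \<in> Psi E x \<Longrightarrow> det N \<le> det M"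
    and K: "pos_def K" "M ** K = mat 1"
    and ij: "i \<noteq> j" "{i, j} \<notin> E"
  shows "K $ i $ j = 0"
proof -
  define B :: "real^'v^'v" where "B = (\<chi> a b. of_bool (a = i \<and> b = j \<or> a = j \<and> b = i))"
  have pd: "pos_def M" using M by (simp add: Psi_def)
  have B: "transpose B = B" by (auto simp: B_def transpose_def vec_eq_iff)
  obtain d where d: "d > 0" "\<And>t. \<bar>t\<bar> < d \<Longrightarrow> pos_def (M + t *\<^sub>R B)"
    using pos_def_perturb[OF pd B] by blast
  have in_Psi: "M + t *\<^sub>R B \<in> Psi E x" if "\<bar>t\<bar> < d" for t
    using M d(2)[OF that] ij by (auto simp: Psi_def B_def insert_commute)
  have eq: "det (M + t *\<^sub>R B) = det M * det (mat 1 + t *\<^sub>R (K ** B))" for t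
  proof -
    have "M ** (mat 1 + t *\<^sub>R (K ** B)) = M + t *\<^sub>R B"
      by (simp add: matrix_add_ldistrib matrix_scalar_ac scalar_matrix_assoc[symmetric] matrix_mul_assoc K)
    then show ?thesis by (metis det_mul)
  qed
  have "((\<lambda>t. det (M + t *\<^sub>R B)) has_field_derivative det M * trace (K ** B)) (at 0)"
    unfolding eq by (intro DERIV_cmult has_derivative_det_at_one)
  then have "det M * trace (K ** B) = 0"
    by (rule DERIV_local_max[OF _ d(1)]) (auto intro!: max in_Psi)
  then have "trace (K ** B) = 0" using hadamard_inequality(1)[OF pd] by simp
  moreover have "trace (K ** B) = 2 * K $ i $ j"
  proof -
    have "(K ** B) $ a $ a = (if a = i then K $ i $ j else 0) + (if a = j then K $ j $ i else 0)" for a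
    proof -
      have "(K ** B) $ a $ a = (\<Sum>k\<in>UNIV. (if k = j then if a = i then K $ i $ j else 0 else 0)
          + (if k = i then if a = j then K $ j $ i else 0 else 0))"
        unfolding matrix_matrix_mult_def vec_lambda_beta using ij
        by (intro sum.cong) (auto simp: B_def)
      then show ?thesis by (simp add: sum.distrib)
    qed
    then have "trace (K ** B) = K $ i $ j + K $ j $ i" by (simp add: trace_def sum.distrib)
    then show ?thesis using pos_def_sym[OF K(1), of i j] by simp
  qed
  ultimately show ?thesis by simp
qed

lemma pos_semidef_det_nonzero:
  fixes M :: "real^'n^'n"
  assumes sym: "transpose M = M" and nn: "\<And>v. 0 \<le> quad_form M v" and det: "det M \<noteq> 0"
  shows "pos_def M"
proof -
  have "quad_form M v \<noteq> 0" if v: "v \<noteq> 0" for v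
  proof
    assume q0: "quad_form M v = 0"
    define w where "w = M *v v"
    have "w \<noteq> 0"
      using det v unfolding w_def
      by (metis invertible_det_nz matrix_left_invertible_ker invertible_def)
    then have w: "w \<bullet> w > 0" by simp
    have vw: "v \<bullet> (M *v w) = w \<bullet> w"
      using dot_lmul_matrix[of v M w] transpose_matrix_vector[of M v] sym by (simp add: w_def)
    have exp: "quad_form M (v - t *\<^sub>R w) = t\<^sup>2 * quad_form M w - 2 * t * (w \<bullet> w)" for t
      using q0 vw unfolding quad_form_def w_def[symmetric]
      by (simp add: matrix_vector_mult_diff_distrib matrix_vector_mult_scaleR inner_diff_left
          inner_diff_right w_def[symmetric] power2_eq_square algebra_simps)
    \<comment> \<open>Small enough for the term linear in \<open>t\<close> to win over the quadratic one; the \<open>1\<close> avoids a division by zero.\<close>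
    define t where "t = (w \<bullet> w) / (quad_form M w + 1)"
    have t: "t > 0" using w nn[of w] by (simp add: t_def)
    have "t * quad_form M w \<le> w \<bullet> w"
      using w nn[of w] by (simp add: t_def field_simps)
    then have "t * (t * quad_form M w) \<le> t * (w \<bullet> w)" using t by (intro mult_left_mono) auto
    then have "quad_form M (v - t *\<^sub>R w) < 0"
      using mult_pos_pos[OF t w] unfolding exp power2_eq_square mult.assoc by linarith
    then show False using nn[of "v - t *\<^sub>R w"] by simp
  qed
  then show ?thesis using sym nn by (auto simp: pos_def_quad_form less_le)
qed

text \<open>\<open>Psi\<close> need not be closed; the maximum is first taken over the positive semidefinite
matrices with the same prescribed entries, a set that is compact because the entries of a positive
semidefinite matrix with unit diagonal lie in $[-1,1]$. A maximizer has positive determinant, hence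
is positive definite after all.\<close>
lemma det_attains_max_on_Psi:
  fixes E :: "'v::finite set set"
  assumes ne: "Psi E x \<noteq> {}"
  obtains M where "M \<in> Psi E x" "\<And>N. N \<in> Psi E x \<Longrightarrow> det N \<le> det M"
proof -
  define S :: "(real^'v^'v) set" where "S = {M. (\<forall>i j. M $ i $ j = M $ j $ i) \<and> (\<forall>v. 0 \<le> quad_form M v) \<and>
    (\<forall>i. M $ i $ i = 1) \<and> (\<forall>i j. {i, j} \<in> E \<longrightarrow> M $ i $ j = x)}"
  have sub: "Psi E x \<subseteq> S"
  proof
    fix M assume M: "M \<in> Psi E x"
    then have pd: "pos_def M" by (simp add: Psi_def)
    then have "0 \<le> quad_form M v" for v
      by (cases "v = 0") (auto simp: pos_def_quad_form less_imp_le quad_form_def)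
    then show "M \<in> S" using M pos_def_sym[OF pd] by (auto simp: S_def Psi_def)
  qed
  have "closed S"
    unfolding S_def quad_form_sum
    by (intro closed_Collect_conj closed_Collect_all closed_Collect_imp closed_Collect_eq
        closed_Collect_le continuous_intros) auto
  moreover have "bounded S"
  proof (rule boundedI)
    fix M assume M: "M \<in> S"
    have "\<bar>M $ i $ j\<bar> \<le> 1" for i j
    proof -
      have q: "quad_form M (axis i 1 + s *\<^sub>R axis j 1) = M $ i $ i + 2 * s * M $ i $ j + s\<^sup>2 * M $ j $ j" for s
        using M unfolding quad_form_def S_def
        by (simp add: matrix_vector_right_distrib matrix_vector_mult_scaleR matrix_vector_mult_basis
            inner_add_left inner_axis' column_def power2_eq_square algebra_simps)
      have "quad_form M (axis i 1 + 1 *\<^sub>R axis j 1) \<ge> 0" "quad_form M (axis i 1 + (-1) *\<^sub>R axis j 1) \<ge> 0"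
        using M by (auto simp: S_def)
      then show ?thesis using M unfolding q by (simp add: S_def)
    qed
    then have "norm (M $ i) \<le> (\<Sum>j\<in>(UNIV::'v set). 1)" for i
      by (intro order_trans[OF norm_le_l1_cart] sum_mono)
    then have "(\<Sum>i\<in>UNIV. norm (M $ i)) \<le> (\<Sum>i\<in>(UNIV::'v set). \<Sum>j\<in>(UNIV::'v set). 1)"
      by (intro sum_mono)
    then show "norm M \<le> (\<Sum>i\<in>(UNIV::'v set). \<Sum>j\<in>(UNIV::'v set). 1)"
      unfolding norm_vec_def by (intro order_trans[OF L2_set_le_sum]) auto
  qed
  ultimately have "compact S" by (simp add: compact_eq_bounded_closed)
  moreover have "S \<noteq> {}" using ne sub by auto
  moreover have "continuous_on S det" unfolding det_def by (intro continuous_intros)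
  ultimately obtain M where M: "M \<in> S" and max: "\<And>N. N \<in> S \<Longrightarrow> det N \<le> det M"
    using continuous_attains_sup[of S det] by metis
  obtain N where N: "N \<in> Psi E x" using ne by auto
  then have "0 < det N" by (auto simp: Psi_def hadamard_inequality(1))
  then have "det M \<noteq> 0" using max[of N] N sub by auto
  then have "pos_def M" using M
    by (intro pos_semidef_det_nonzero) (auto simp: S_def transpose_def vec_eq_iff)
  then have "M \<in> Psi E x" using M by (auto simp: S_def Psi_def)
  then show thesis using that max sub by blast
qed

text \<open>The matrix \<open>K\<close> is the inverse of \<open>Sigma_mat E x\<close>. Since it is supported
where all members \<open>N\<close> of \<open>Psi\<close> agree, \<open>trace (K ** N)\<close> is the
same for all of them; this gives the uniqueness of the maximizer and makes \<open>K\<close> the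
right exponent in the large deviation bound for the density of the graph.\<close>
lemma tau_dual_matrix:
  fixes E :: "'v::finite set set"
  assumes ne: "Psi E x \<noteq> {}"
  obtains M K where "M \<in> Psi E x" "pos_def K" "K ** M = mat 1" "det K * tau E x = 1"
    "\<And>i j. i \<noteq> j \<Longrightarrow> {i, j} \<notin> E \<Longrightarrow> K $ i $ j = 0"
proof -
  obtain M where M: "M \<in> Psi E x" and max: "\<And>N. N \<in> Psi E x \<Longrightarrow> det N \<le> det M"
    using det_attains_max_on_Psi[OF ne] by blast
  have "pos_def M" using M by (simp add: Psi_def)
  then obtain K where K: "pos_def K" "K ** M = mat 1" "M ** K = mat 1" "det K * det M = 1"
    using pos_def_inverse by blast
  have sparse: "K $ i $ j = 0" if "i \<noteq> j" "{i, j} \<notin> E" for i j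
    using inverse_of_maximizer_vanishes[OF M max K(1,3)] that by blast
  have unique: "N = M" if N: "is_arg_max det (\<lambda>M. M \<in> Psi E x) N" for N
  proof -
    have NP: "N \<in> Psi E x" and "det N \<ge> det M" using N M by (auto simp: is_arg_max_def not_less)
    then have det: "det N = det M" using max by (simp add: order_antisym)
    have "K $ i $ k * N $ k $ i = K $ i $ k * M $ k $ i" for i k
      using sparse[of i k] NP M by (cases "i = k"; cases "{i, k} \<in> E") (auto simp: Psi_def insert_commute)
    then have "trace (K ** N) = trace (K ** M)"
      unfolding trace_def matrix_matrix_mult_def vec_lambda_beta by (intro sum.cong refl)
    then have "trace (K ** N) = real CARD('v)" by (simp add: K(2) trace_I)
    then have "K ** N = mat 1"
      using K det NP by (intro mult_eq_one_if_det_trace) (auto simp: Psi_def)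
    then have "M ** K ** N = M" by (simp add: matrix_mul_assoc[symmetric])
    then show "N = M" using K(3) by simp
  qed
  have "is_arg_max det (\<lambda>M. M \<in> Psi E x) M"
    using M max by (auto simp: is_arg_max_def not_less)
  then have "Sigma_mat E x = M" unfolding Sigma_mat_def using unique by (rule the_equality)
  then have "tau E x = det M" by (simp add: tau_def)
  then show thesis using that M K sparse by simp
qed

section \<open>The Sidorenko inequality for measurable kernels\<close>

lemma power_ge_tangent:
  fixes y c :: real
  assumes "0 \<le> y" "0 \<le> c"
  shows "c ^ m + real m * c ^ (m - 1) * (y - c) \<le> y ^ m"
proof (induction m)
  case 0 show ?case by simp
next
  case (Suc m)
  have "c ^ Suc m + real (Suc m) * c ^ (Suc m - 1) * (y - c)
      \<le> c ^ Suc m + real (Suc m) * c ^ (Suc m - 1) * (y - c) + real m * c ^ (m - 1) * (y - c)\<^sup>2"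
    using assms by simp
  also have "\<dots> = y * (c ^ m + real m * c ^ (m - 1) * (y - c))"
    by (cases m) (simp_all add: algebra_simps power2_eq_square)
  also have "\<dots> \<le> y * y ^ m" using Suc assms by (intro mult_left_mono) auto
  finally show ?case by simp
qed

text \<open>Jensen's inequality on the closed half line, from the tangent of the power at the mean.\<close>
lemma (in prob_space) expectation_power_ge:
  fixes X :: "'a \<Rightarrow> real"
  assumes X: "integrable M X" "integrable M (\<lambda>\<omega>. X \<omega> ^ m)" and nn: "\<And>\<omega>. 0 \<le> X \<omega>"
  shows "expectation X ^ m \<le> expectation (\<lambda>\<omega>. X \<omega> ^ m)"
proof -
  let ?c = "expectation X"
  have c: "0 \<le> ?c" using nn by (intro integral_nonneg_AE) auto
  have "(\<integral>\<omega>. ?c ^ m + real m * ?c ^ (m - 1) * (X \<omega> - ?c) \<partial>M) \<le> (\<integral>\<omega>. X \<omega> ^ m \<partial>M)"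
    using X by (intro integral_mono power_ge_tangent nn c) auto
  then show ?thesis using X by (simp add: prob_space)
qed

text \<open>A union bound over the pairs \<open>i \<noteq> j\<close> in \<open>V\<close>: a map with
\<open>f i = f j\<close> is determined by its restriction to \<open>V - {i}\<close>.\<close>
lemma card_noninjective_le:
  assumes V: "finite V" and W: "finite W" "W \<noteq> {}"
  shows "real (card {f \<in> V \<rightarrow>\<^sub>E W. \<not> inj_on f V}) * real (card W)
    \<le> (real (card V))\<^sup>2 * real (card (V \<rightarrow>\<^sub>E W))"
proof -
  let ?B = "\<lambda>p. {f \<in> V \<rightarrow>\<^sub>E W. f (fst p) = f (snd p)}"
  let ?P = "{p \<in> V \<times> V. fst p \<noteq> snd p}"
  have fin: "finite (V \<rightarrow>\<^sub>E W)" using V W by (intro finite_PiE) auto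
  have one: "card (?B p) * card W \<le> card (V \<rightarrow>\<^sub>E W)" if p: "p \<in> ?P" for p
  proof -
    obtain i j where ij: "p = (i, j)" "i \<in> V" "j \<in> V" "i \<noteq> j" using p by auto
    have "card (?B p) \<le> card ((V - {i}) \<rightarrow>\<^sub>E W)"
    proof (rule card_inj_on_le)
      show "inj_on (\<lambda>f. restrict f (V - {i})) (?B p)"
      proof (rule inj_onI)
        fix f g assume f: "f \<in> ?B p" and g: "g \<in> ?B p"
          and eq: "restrict f (V - {i}) = restrict g (V - {i})"
        have e: "f k = g k" if "k \<in> V - {i}" for k
          using fun_cong[OF eq, of k] that by simp
        have "f i = g i" using e[of j] f g ij by auto
        with e have "f k = g k" if "k \<in> V" for k using that by (cases "k = i") auto
        moreover have "f \<in> V \<rightarrow>\<^sub>E W" "g \<in> V \<rightarrow>\<^sub>E W" using f g by auto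
        ultimately show "f = g" by (intro PiE_ext) auto
      qed
      show "(\<lambda>f. restrict f (V - {i})) ` ?B p \<subseteq> (V - {i}) \<rightarrow>\<^sub>E W"
        by (rule image_subsetI, subst restrict_PiE_iff) auto
      show "finite ((V - {i}) \<rightarrow>\<^sub>E W)" using V W by (intro finite_PiE) auto
    qed
    then have "card (?B p) * card W \<le> card ((V - {i}) \<rightarrow>\<^sub>E W) * card W" by (rule mult_right_mono) simp
    also have "\<dots> = card W ^ (card V - 1) * card W"
      using V ij by (simp add: card_PiE)
    also have "\<dots> = card W ^ card V"
      using V ij by (metis card_Diff_singleton card_Suc_Diff1 power_Suc2)
    also have "\<dots> = card (V \<rightarrow>\<^sub>E W)" using V by (simp add: card_PiE)
    finally show ?thesis .
  qed
  have "{f \<in> V \<rightarrow>\<^sub>E W. \<not> inj_on f V} \<subseteq> (\<Union>p\<in>?P. ?B p)"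
    by (auto simp: inj_on_def)
  then have "card {f \<in> V \<rightarrow>\<^sub>E W. \<not> inj_on f V} \<le> card (\<Union>p\<in>?P. ?B p)"
    using V fin by (intro card_mono) auto
  also have "\<dots> \<le> (\<Sum>p\<in>?P. card (?B p))" using V by (intro card_UN_le) auto
  finally have "card {f \<in> V \<rightarrow>\<^sub>E W. \<not> inj_on f V} * card W \<le> (\<Sum>p\<in>?P. card (?B p) * card W)"
    by (simp add: sum_distrib_right[symmetric])
  also have "\<dots> \<le> (\<Sum>p\<in>?P. card (V \<rightarrow>\<^sub>E W))" by (intro sum_mono one)
  also have "\<dots> \<le> (\<Sum>p\<in>V\<times>V. card (V \<rightarrow>\<^sub>E W))" using V by (intro sum_mono2) auto
  also have "\<dots> = (card V)\<^sup>2 * card (V \<rightarrow>\<^sub>E W)"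
    by (simp add: card_cartesian_product power2_eq_square)
  finally have "real (card {f \<in> V \<rightarrow>\<^sub>E W. \<not> inj_on f V} * card W) \<le> real ((card V)\<^sup>2 * card (V \<rightarrow>\<^sub>E W))"
    by (simp only: of_nat_le_iff)
  then show ?thesis by simp
qed

text \<open>The density of $G = (V,E)$ in the possibly infinite graph on the points of \<open>M\<close> with
adjacency relation \<open>A\<close>, where the vertices of \<open>G\<close> are mapped to
independent points with law \<open>M\<close>. In the language of graph limits this is the
homomorphism density of the graphon \<open>A\<close>, which takes only the values zero and one.\<close>
definition kernel_density :: "'a set \<Rightarrow> 'a set set \<Rightarrow> 'b measure \<Rightarrow> ('b \<Rightarrow> 'b \<Rightarrow> bool) \<Rightarrow> real" where
  "kernel_density V E M A = measure (\<Pi>\<^sub>M i\<in>V. M)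
     {\<omega> \<in> space (\<Pi>\<^sub>M i\<in>V. M). \<forall>i\<in>V. \<forall>j\<in>V. {i, j} \<in> E \<longrightarrow> A (\<omega> i) (\<omega> j)}"

definition sample_graph :: "nat \<Rightarrow> ('b \<Rightarrow> 'b \<Rightarrow> bool) \<Rightarrow> (nat \<Rightarrow> 'b) \<Rightarrow> nat set set" where
  "sample_graph N A \<omega> = {{r, s} |r s. r < N \<and> s < N \<and> r \<noteq> s \<and> A (\<omega> r) (\<omega> s)}"

lemma simple_sample_graph: "simple_graph {..<N} (sample_graph N A \<omega>)"
  by (auto simp: simple_graph_def sample_graph_def)

lemma edge_sample_graph_iff:
  assumes "symp A" "r < N" "s < N"
  shows "{r, s} \<in> sample_graph N A \<omega> \<longleftrightarrow> r \<noteq> s \<and> A (\<omega> r) (\<omega> s)"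
  using assms by (auto simp: sample_graph_def doubleton_eq_iff dest: sympD)

lemma hom_into_sample_graph_iff:
  assumes "simple_graph V E" "symp A" "f \<in> V \<rightarrow>\<^sub>E {..<N}"
  shows "(\<forall>e\<in>E. f ` e \<in> sample_graph N A \<omega>) \<longleftrightarrow>
    (\<forall>i\<in>V. \<forall>j\<in>V. {i, j} \<in> E \<longrightarrow> f i \<noteq> f j \<and> A (\<omega> (f i)) (\<omega> (f j)))"
proof -
  have iff: "f ` {i, j} \<in> sample_graph N A \<omega> \<longleftrightarrow> f i \<noteq> f j \<and> A (\<omega> (f i)) (\<omega> (f j))"
    if "i \<in> V" "j \<in> V" for i j
    using edge_sample_graph_iff[OF assms(2), of "f i" N "f j" \<omega>] assms(3) that by (auto simp: PiE_iff)
  have ends: "\<exists>i j. e = {i, j} \<and> i \<in> V \<and> j \<in> V" if "e \<in> E" for e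
  proof -
    have "e \<subseteq> V" "card e = 2" using assms(1) that by (auto simp: simple_graph_def)
    then show ?thesis by (metis card_2_iff insert_subset)
  qed
  show ?thesis
  proof (intro iffI ballI)
    fix e
    assume r: "\<forall>i\<in>V. \<forall>j\<in>V. {i, j} \<in> E \<longrightarrow> f i \<noteq> f j \<and> A (\<omega> (f i)) (\<omega> (f j))" and e: "e \<in> E"
    obtain i j where ij: "e = {i, j}" "i \<in> V" "j \<in> V" using ends[OF e] by blast
    with r e have "f i \<noteq> f j \<and> A (\<omega> (f i)) (\<omega> (f j))" by blast
    then show "f ` e \<in> sample_graph N A \<omega>" unfolding ij(1) iff[OF ij(2,3)] .
  qed (use iff in blast)
qed

locale symmetric_kernel = prob_space M for M :: "'b measure" +
  fixes A :: "'b \<Rightarrow> 'b \<Rightarrow> bool"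
  assumes sym: "symp A"
    and meas [measurable]: "Measurable.pred (M \<Otimes>\<^sub>M M) (\<lambda>(u, v). A u v)"
begin

lemma pred_kernel [measurable (raw)]:
  assumes [measurable]: "f \<in> measurable N M" "g \<in> measurable N M"
  shows "Measurable.pred N (\<lambda>x. A (f x) (g x))"
proof -
  have "Measurable.pred N (\<lambda>x. case (f x, g x) of (u, v) \<Rightarrow> A u v)" by measurable
  then show ?thesis by simp
qed

abbreviation sample :: "nat \<Rightarrow> (nat \<Rightarrow> 'b) measure" where
  "sample N \<equiv> (\<Pi>\<^sub>M r\<in>{..<N}. M)"

lemma prob_space_sample: "prob_space (sample N)"
  by (intro prob_space_PiM prob_space_axioms)

lemma measurable_hom_event:
  assumes "finite V" "f \<in> V \<rightarrow>\<^sub>E {..<N}"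
  shows "Measurable.pred (sample N)
    (\<lambda>\<omega>. \<forall>i\<in>V. \<forall>j\<in>V. {i, j} \<in> E \<longrightarrow> f i \<noteq> f j \<and> A (\<omega> (f i)) (\<omega> (f j)))"
proof -
  have [measurable]: "(\<lambda>\<omega>. \<omega> (f i)) \<in> measurable (sample N) M" if "i \<in> V" for i
    using assms that by (intro measurable_component_singleton) auto
  have "Measurable.pred (sample N) (\<lambda>\<omega>. {i, j} \<in> E \<longrightarrow> f i \<noteq> f j \<and> A (\<omega> (f i)) (\<omega> (f j)))"
    if "i \<in> V" "j \<in> V" for i j using that by measurable
  then show ?thesis using assms(1) by (intro pred_intros_finite) auto
qed

definition hom_prob :: "'a set \<Rightarrow> 'a set set \<Rightarrow> nat \<Rightarrow> ('a \<Rightarrow> nat) \<Rightarrow> real" where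
  "hom_prob V E N f = measure (sample N) {\<omega> \<in> space (sample N).
     \<forall>i\<in>V. \<forall>j\<in>V. {i, j} \<in> E \<longrightarrow> f i \<noteq> f j \<and> A (\<omega> (f i)) (\<omega> (f j))}"

lemma hom_prob_injective:
  assumes G: "simple_graph V E" and f: "f \<in> V \<rightarrow>\<^sub>E {..<N}" "inj_on f V"
  shows "hom_prob V E N f = kernel_density V E M A"
proof -
  have V: "finite V" using G by (simp add: simple_graph_def)
  let ?t = "\<lambda>\<omega>. \<lambda>i\<in>V. \<omega> (f i)"
  let ?S = "{\<omega> \<in> space (\<Pi>\<^sub>M i\<in>V. M). \<forall>i\<in>V. \<forall>j\<in>V. {i, j} \<in> E \<longrightarrow> A (\<omega> i) (\<omega> j)}"
  have ne: "i \<noteq> j" if "{i, j} \<in> E" for i j using G that by (fastforce simp: simple_graph_def)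
  have distr: "distr (sample N) (\<Pi>\<^sub>M i\<in>V. M) ?t = (\<Pi>\<^sub>M i\<in>V. M)"
    using f by (intro distr_PiM_reindex prob_space_axioms) auto
  have t: "?t \<in> measurable (sample N) (\<Pi>\<^sub>M i\<in>V. M)"
    using f by (intro measurable_restrict measurable_component_singleton) auto
  have S: "?S \<in> sets (\<Pi>\<^sub>M i\<in>V. M)"
    using V by measurable
  have "kernel_density V E M A = measure (distr (sample N) (\<Pi>\<^sub>M i\<in>V. M) ?t) ?S"
    by (simp add: kernel_density_def distr)
  also have "\<dots> = measure (sample N) (?t -` ?S \<inter> space (sample N))"
    by (rule measure_distr[OF t S])
  also have "?t -` ?S \<inter> space (sample N) = {\<omega> \<in> space (sample N).
     \<forall>i\<in>V. \<forall>j\<in>V. {i, j} \<in> E \<longrightarrow> f i \<noteq> f j \<and> A (\<omega> (f i)) (\<omega> (f j))}"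
  proof -
    have "f i \<noteq> f j" if "{i, j} \<in> E" "i \<in> V" "j \<in> V" for i j
      using ne[OF that(1)] that f(2) by (auto dest: inj_onD)
    moreover have "?t \<omega> \<in> space (\<Pi>\<^sub>M i\<in>V. M)" if "\<omega> \<in> space (sample N)" for \<omega>
      using measurable_space[OF t that] .
    ultimately show ?thesis by auto
  qed
  finally show ?thesis by (simp add: hom_prob_def)
qed

lemma hom_density_sample_graph:
  assumes G: "simple_graph V E" and N: "N > 0"
  shows "hom_density V E {..<N} (sample_graph N A \<omega>)
    = (\<Sum>f\<in>V \<rightarrow>\<^sub>E {..<N}. of_bool (\<forall>i\<in>V. \<forall>j\<in>V. {i, j} \<in> E \<longrightarrow> f i \<noteq> f j \<and> A (\<omega> (f i)) (\<omega> (f j))))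
      / real (card (V \<rightarrow>\<^sub>E {..<N}))"
proof -
  have fin: "finite (V \<rightarrow>\<^sub>E {..<N})" using G by (intro finite_PiE) (auto simp: simple_graph_def)
  have ne: "V \<rightarrow>\<^sub>E {..<N} \<noteq> {}" using N by (auto simp: PiE_eq_empty_iff)
  have "(V \<rightarrow>\<^sub>E {..<N}) \<inter> {f. \<forall>e\<in>E. f ` e \<in> sample_graph N A \<omega>}
    = {f \<in> V \<rightarrow>\<^sub>E {..<N}. \<forall>i\<in>V. \<forall>j\<in>V. {i, j} \<in> E \<longrightarrow> f i \<noteq> f j \<and> A (\<omega> (f i)) (\<omega> (f j))}"
    using hom_into_sample_graph_iff[OF G sym] by blast
  then show ?thesis
    using fin by (simp add: hom_density_def measure_pmf_of_set[OF ne fin] sum_of_bool_eq Int_def)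
qed

text \<open>Linearity of the expectation, the density being an average over the maps \<open>f\<close>.\<close>
lemma expectation_hom_density:
  assumes G: "simple_graph V E" and N: "N > 0"
  shows "integrable (sample N) (\<lambda>\<omega>. hom_density V E {..<N} (sample_graph N A \<omega>))"
    and "integrable (sample N) (\<lambda>\<omega>. hom_density V E {..<N} (sample_graph N A \<omega>) ^ m)"
    and "(\<integral>\<omega>. hom_density V E {..<N} (sample_graph N A \<omega>) \<partial>sample N)
      = (\<Sum>f\<in>V \<rightarrow>\<^sub>E {..<N}. hom_prob V E N f) / real (card (V \<rightarrow>\<^sub>E {..<N}))"
proof -
  interpret S: prob_space "sample N" by (rule prob_space_sample)
  have V: "finite V" using G by (simp add: simple_graph_def)
  let ?P = "\<lambda>f \<omega>. \<forall>i\<in>V. \<forall>j\<in>V. {i, j} \<in> E \<longrightarrow> f i \<noteq> f j \<and> A (\<omega> (f i)) (\<omega> (f j))"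
  have m: "Measurable.pred (sample N) (?P f)" if "f \<in> V \<rightarrow>\<^sub>E {..<N}" for f
    by (rule measurable_hom_event[OF V that])
  then have b: "(\<lambda>\<omega>. of_bool (?P f \<omega>) :: real) \<in> borel_measurable (sample N)"
    if "f \<in> V \<rightarrow>\<^sub>E {..<N}" for f using that by measurable
  have i: "integrable (sample N) (\<lambda>\<omega>. of_bool (?P f \<omega>) :: real)" if "f \<in> V \<rightarrow>\<^sub>E {..<N}" for f
    by (rule S.integrable_const_bound[of _ 1]) (use b[OF that] in auto)
  have e: "(\<integral>\<omega>. of_bool (?P f \<omega>) \<partial>sample N) = hom_prob V E N f" if "f \<in> V \<rightarrow>\<^sub>E {..<N}" for f
  proof -
    have "(\<integral>\<omega>. of_bool (?P f \<omega>) \<partial>sample N)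
      = (\<integral>\<omega>. indicat_real {\<omega> \<in> space (sample N). ?P f \<omega>} \<omega> \<partial>sample N)"
      by (intro Bochner_Integration.integral_cong) (auto simp: indicator_def)
    also have "\<dots> = measure (sample N) ({\<omega> \<in> space (sample N). ?P f \<omega>} \<inter> space (sample N))"
      by (rule Bochner_Integration.integral_indicator)
    also have "{\<omega> \<in> space (sample N). ?P f \<omega>} \<inter> space (sample N) = {\<omega> \<in> space (sample N). ?P f \<omega>}"
      by blast
    finally show ?thesis by (simp add: hom_prob_def)
  qed
  show 1: "integrable (sample N) (\<lambda>\<omega>. hom_density V E {..<N} (sample_graph N A \<omega>))"
    unfolding hom_density_sample_graph[OF G N] by (intro integrable_divide Bochner_Integration.integrable_sum i)
  show "integrable (sample N) (\<lambda>\<omega>. hom_density V E {..<N} (sample_graph N A \<omega>) ^ m)"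
    using 1 by (intro S.integrable_const_bound[of _ 1])
      (auto simp: hom_density_def intro!: power_le_one borel_measurable_power)
  show "(\<integral>\<omega>. hom_density V E {..<N} (sample_graph N A \<omega>) \<partial>sample N)
      = (\<Sum>f\<in>V \<rightarrow>\<^sub>E {..<N}. hom_prob V E N f) / real (card (V \<rightarrow>\<^sub>E {..<N}))"
    unfolding hom_density_sample_graph[OF G N] using i e
    by (simp add: Bochner_Integration.integral_sum)
qed

text \<open>An injective map sends the vertices to independent points, and only a fraction of at most $|V|^2/N$
of the maps is not injective.\<close>
lemma expectation_hom_density_close:
  assumes G: "simple_graph V E" and N: "N > 0"
  shows "\<bar>(\<integral>\<omega>. hom_density V E {..<N} (sample_graph N A \<omega>) \<partial>sample N) - kernel_density V E M A\<bar>
    \<le> (real (card V))\<^sup>2 / real N"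
proof -
  interpret S: prob_space "sample N" by (rule prob_space_sample)
  interpret PV: prob_space "\<Pi>\<^sub>M i\<in>V. M" by (intro prob_space_PiM prob_space_axioms)
  have V: "finite V" using G by (simp add: simple_graph_def)
  let ?F = "V \<rightarrow>\<^sub>E {..<N}" and ?k = "kernel_density V E M A"
  let ?B = "{f \<in> ?F. \<not> inj_on f V}"
  have fin: "finite ?F" using V by (intro finite_PiE) auto
  have ne: "?F \<noteq> {}" using N by (auto simp: PiE_eq_empty_iff)
  then have c: "real (card ?F) > 0" using fin by (simp add: card_gt_0_iff)
  have "\<bar>hom_prob V E N f - ?k\<bar> \<le> of_bool (\<not> inj_on f V)" if "f \<in> ?F" for f
  proof (cases "inj_on f V")
    case True then show ?thesis using hom_prob_injective[OF G that] by simp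
  next
    case False
    have "0 \<le> hom_prob V E N f" "hom_prob V E N f \<le> 1" "0 \<le> ?k" "?k \<le> 1"
      by (auto simp: hom_prob_def kernel_density_def)
    then show ?thesis using False by simp
  qed
  then have "(\<Sum>f\<in>?F. \<bar>hom_prob V E N f - ?k\<bar>) \<le> (\<Sum>f\<in>?F. of_bool (\<not> inj_on f V))"
    by (intro sum_mono)
  also have "\<dots> = real (card ?B)" using fin by (simp add: sum_of_bool_eq Int_def)
  finally have "\<bar>\<Sum>f\<in>?F. (hom_prob V E N f - ?k)\<bar> \<le> real (card ?B)"
    using sum_abs[of "\<lambda>f. hom_prob V E N f - ?k" ?F] by linarith
  moreover have "real (card ?B) * real N \<le> (real (card V))\<^sup>2 * real (card ?F)"
    using card_noninjective_le[OF V, of "{..<N}"] N by auto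
  then have "real (card ?B) \<le> (real (card V))\<^sup>2 / real N * real (card ?F)"
    using N by (simp add: field_simps)
  ultimately have "\<bar>(\<Sum>f\<in>?F. hom_prob V E N f) - real (card ?F) * ?k\<bar>
      \<le> (real (card V))\<^sup>2 / real N * real (card ?F)"
    by (simp add: sum_subtractf)
  moreover have "(\<Sum>f\<in>?F. hom_prob V E N f) / real (card ?F) - ?k
      = ((\<Sum>f\<in>?F. hom_prob V E N f) - real (card ?F) * ?k) / real (card ?F)"
    using c by (simp add: field_simps)
  ultimately show ?thesis
    unfolding expectation_hom_density(3)[OF G N] using c by (simp add: abs_divide pos_divide_le_eq)
qed

text \<open>The Sidorenko inequality for finite graphs is applied to the random graph on \<open>N\<close>
independent points and averaged; Jensen's inequality is in the right direction to move the power
outside the expectation, and the error vanishes as \<open>N\<close> grows.\<close>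
theorem sidorenko_kernel:
  assumes G: "simple_graph V E" and S: "sidorenko V E"
  shows "kernel_density {0, 1::nat} {{0, 1}} M A ^ card E \<le> kernel_density V E M A"
proof -
  let ?e = "\<lambda>N \<omega>. edge_density {..<N} (sample_graph N A \<omega>)"
  let ?g = "\<lambda>N \<omega>. hom_density V E {..<N} (sample_graph N A \<omega>)"
  let ?I = "\<lambda>X N. \<integral>\<omega>. X N \<omega> \<partial>sample N"
  have G2: "simple_graph {0, 1::nat} {{0, 1}}" by (simp add: simple_graph_def)
  have lim: "(\<lambda>n. ?I (\<lambda>N \<omega>. hom_density U D {..<N} (sample_graph N A \<omega>)) (Suc n)) \<longlonglongrightarrow> kernel_density U D M A"
    if U: "simple_graph U D" for U :: "'c set" and D
  proof (rule LIM_zero_cancel, rule Lim_null_comparison)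
    show "\<forall>\<^sub>F n in sequentially. norm (?I (\<lambda>N \<omega>. hom_density U D {..<N} (sample_graph N A \<omega>)) (Suc n)
        - kernel_density U D M A) \<le> (real (card U))\<^sup>2 / real (Suc n)"
      unfolding real_norm_def
      by (intro always_eventually allI expectation_hom_density_close[OF U]) simp
    show "(\<lambda>n. (real (card U))\<^sup>2 / real (Suc n)) \<longlonglongrightarrow> 0"
      by (intro LIMSEQ_Suc lim_const_over_n)
  qed
  have le: "?I ?e (Suc n) ^ card E \<le> ?I ?g (Suc n)" for n
  proof -
    interpret P: prob_space "sample (Suc n)" by (rule prob_space_sample)
    have "?I ?e (Suc n) ^ card E \<le> (\<integral>\<omega>. ?e (Suc n) \<omega> ^ card E \<partial>sample (Suc n))"
      by (intro P.expectation_power_ge expectation_hom_density G2) (auto simp: hom_density_def)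
    also have "\<dots> \<le> ?I ?g (Suc n)"
    proof (intro integral_mono expectation_hom_density G G2)
      fix \<omega>
      have "{..<Suc n} \<noteq> {}" by auto
      then show "?e (Suc n) \<omega> ^ card E \<le> ?g (Suc n) \<omega>"
        using S simple_sample_graph[of "Suc n" A \<omega>] unfolding sidorenko_def by blast
    qed simp_all
    finally show ?thesis .
  qed
  show ?thesis
    by (rule LIMSEQ_le[OF tendsto_power[OF lim[OF G2]] lim[OF G]]) (use le in blast)
qed

end

section \<open>Finite products of probability spaces\<close>

lemma PiM_density:
  assumes I: "finite I" and M: "sigma_finite_measure M"
    and f [measurable]: "f \<in> borel_measurable M" and D: "sigma_finite_measure (density M f)"
  shows "(\<Pi>\<^sub>M i\<in>I. density M f) = density (\<Pi>\<^sub>M i\<in>I. M) (\<lambda>\<omega>. \<Prod>i\<in>I. f (\<omega> i))"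
proof -
  interpret M: product_sigma_finite "\<lambda>_. M" using M by (simp add: product_sigma_finite_def)
  interpret D: product_sigma_finite "\<lambda>_. density M f" using D by (simp add: product_sigma_finite_def)
  have "density (\<Pi>\<^sub>M i\<in>I. M) (\<lambda>\<omega>. \<Prod>i\<in>I. f (\<omega> i)) = (\<Pi>\<^sub>M i\<in>I. density M f)"
  proof (rule D.PiM_eqI[OF I])
    show "sets (density (\<Pi>\<^sub>M i\<in>I. M) (\<lambda>\<omega>. \<Prod>i\<in>I. f (\<omega> i))) = sets (\<Pi>\<^sub>M i\<in>I. density M f)"
      by (simp cong: sets_PiM_cong)
    fix A assume A: "\<And>i. i \<in> I \<Longrightarrow> A i \<in> sets (density M f)"
    then have A' [measurable]: "\<And>i. i \<in> I \<Longrightarrow> A i \<in> sets M" by simp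
    have "emeasure (density (\<Pi>\<^sub>M i\<in>I. M) (\<lambda>\<omega>. \<Prod>i\<in>I. f (\<omega> i))) (Pi\<^sub>E I A)
      = (\<integral>\<^sup>+\<omega>. (\<Prod>i\<in>I. f (\<omega> i)) * indicator (Pi\<^sub>E I A) \<omega> \<partial>(\<Pi>\<^sub>M i\<in>I. M))"
      using I by (intro emeasure_density) (auto intro!: sets_PiM_I_finite)
    also have "\<dots> = (\<integral>\<^sup>+\<omega>. (\<Prod>i\<in>I. f (\<omega> i) * indicator (A i) (\<omega> i)) \<partial>(\<Pi>\<^sub>M i\<in>I. M))"
    proof (intro nn_integral_cong)
      fix \<omega> assume w: "\<omega> \<in> space (\<Pi>\<^sub>M i\<in>I. M)"
      show "(\<Prod>i\<in>I. f (\<omega> i)) * indicator (Pi\<^sub>E I A) \<omega> = (\<Prod>i\<in>I. f (\<omega> i) * indicator (A i) (\<omega> i))"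
      proof (cases "\<omega> \<in> Pi\<^sub>E I A")
        case True
        then show ?thesis by (auto simp: PiE_iff indicator_def intro!: prod.cong)
      next
        case False
        then obtain i where "i \<in> I" "\<omega> i \<notin> A i" using w by (auto simp: space_PiM PiE_iff)
        then have "(\<Prod>i\<in>I. f (\<omega> i) * indicator (A i) (\<omega> i)) = 0"
          using I by (intro prod_zero) (auto intro!: bexI[of _ i])
        then show ?thesis using False by simp
      qed
    qed
    also have "\<dots> = (\<Prod>i\<in>I. \<integral>\<^sup>+y. f y * indicator (A i) y \<partial>M)"
      using I by (intro M.product_nn_integral_prod) auto
    also have "\<dots> = (\<Prod>i\<in>I. emeasure (density M f) (A i))"
      by (intro prod.cong refl) (simp add: emeasure_density)
    finally show "emeasure (density (\<Pi>\<^sub>M i\<in>I. M) (\<lambda>\<omega>. \<Prod>i\<in>I. f (\<omega> i))) (Pi\<^sub>E I A)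
      = (\<Prod>i\<in>I. emeasure (density M f) (A i))" .
  qed
  then show ?thesis by simp
qed

text \<open>The blocks of coordinates with the same first index are independent, and each has the law
\<open>\<Pi>\<^sub>M j\<in>J. M\<close>.\<close>
lemma PiM_curry:
  assumes M: "prob_space M" and I: "I \<noteq> {}" and J: "J \<noteq> {}"
  shows "distr (\<Pi>\<^sub>M p\<in>I \<times> J. M) (\<Pi>\<^sub>M i\<in>I. \<Pi>\<^sub>M j\<in>J. M) (\<lambda>\<omega>. \<lambda>i\<in>I. \<lambda>j\<in>J. \<omega> (i, j)) = (\<Pi>\<^sub>M i\<in>I. \<Pi>\<^sub>M j\<in>J. M)"
proof -
  interpret Q: prob_space "\<Pi>\<^sub>M p\<in>I \<times> J. M" by (intro prob_space_PiM M)
  have comp: "distr (\<Pi>\<^sub>M p\<in>I \<times> J. M) M (\<lambda>\<omega>. \<omega> p) = M" if "p \<in> I \<times> J" for p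
    using that by (intro distr_PiM_component M)
  have "Q.indep_vars (\<lambda>_. M) (\<lambda>p \<omega>. \<omega> p) (I \<times> J)"
  proof (subst Q.indep_vars_iff_distr_eq_PiM')
    have "distr (\<Pi>\<^sub>M p\<in>I \<times> J. M) (\<Pi>\<^sub>M p\<in>I \<times> J. M) (\<lambda>\<omega>. \<lambda>p\<in>I \<times> J. \<omega> p)
      = distr (\<Pi>\<^sub>M p\<in>I \<times> J. M) (\<Pi>\<^sub>M p\<in>I \<times> J. M) (\<lambda>\<omega>. \<omega>)"
      by (intro distr_cong) (auto simp: space_PiM PiE_def extensional_restrict)
    also have "\<dots> = (\<Pi>\<^sub>M p\<in>I \<times> J. M)" by (simp add: distr_id2)
    also have "\<dots> = (\<Pi>\<^sub>M p\<in>I \<times> J. distr (\<Pi>\<^sub>M p\<in>I \<times> J. M) M (\<lambda>\<omega>. \<omega> p))"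
      by (intro PiM_cong refl comp[symmetric])
    finally show "distr (\<Pi>\<^sub>M p\<in>I \<times> J. M) (\<Pi>\<^sub>M p\<in>I \<times> J. M) (\<lambda>\<omega>. \<lambda>p\<in>I \<times> J. \<omega> p)
      = (\<Pi>\<^sub>M p\<in>I \<times> J. distr (\<Pi>\<^sub>M p\<in>I \<times> J. M) M (\<lambda>\<omega>. \<omega> p))" .
  qed (use I J in \<open>auto intro: measurable_component_singleton\<close>)
  then have "Q.indep_vars (\<lambda>i. \<Pi>\<^sub>M p\<in>{i} \<times> J. M) (\<lambda>i \<omega>. restrict (\<lambda>p. \<omega> p) ({i} \<times> J)) I"
    by (rule Q.indep_vars_restrict) (auto simp: disjoint_family_on_def)
  then have "Q.indep_vars (\<lambda>i. \<Pi>\<^sub>M j\<in>J. M)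
      (\<lambda>i \<omega>. (\<lambda>\<eta>. \<lambda>j\<in>J. \<eta> (i, j)) (restrict (\<lambda>p. \<omega> p) ({i} \<times> J))) I"
    by (rule Q.indep_vars_compose2) (intro measurable_restrict measurable_component_singleton, simp)
  then have indep: "Q.indep_vars (\<lambda>i. \<Pi>\<^sub>M j\<in>J. M) (\<lambda>i \<omega>. \<lambda>j\<in>J. \<omega> (i, j)) I"
    by (simp cong: restrict_cong)
  have rv: "(\<lambda>\<omega>. \<lambda>j\<in>J. \<omega> (i, j)) \<in> measurable (\<Pi>\<^sub>M p\<in>I \<times> J. M) (\<Pi>\<^sub>M j\<in>J. M)" if "i \<in> I" for i
    using that by (intro measurable_restrict measurable_component_singleton) auto
  have block: "distr (\<Pi>\<^sub>M p\<in>I \<times> J. M) (\<Pi>\<^sub>M j\<in>J. M) (\<lambda>\<omega>. \<lambda>j\<in>J. \<omega> (i, j)) = (\<Pi>\<^sub>M j\<in>J. M)"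
    if "i \<in> I" for i
    using that by (intro distr_PiM_reindex[of "I \<times> J" "\<lambda>_. M" "\<lambda>j. (i, j)" J, simplified] M)
      (auto simp: inj_on_def)
  have "distr (\<Pi>\<^sub>M p\<in>I \<times> J. M) (\<Pi>\<^sub>M i\<in>I. \<Pi>\<^sub>M j\<in>J. M) (\<lambda>\<omega>. \<lambda>i\<in>I. \<lambda>j\<in>J. \<omega> (i, j))
    = (\<Pi>\<^sub>M i\<in>I. distr (\<Pi>\<^sub>M p\<in>I \<times> J. M) (\<Pi>\<^sub>M j\<in>J. M) (\<lambda>\<omega>. \<lambda>j\<in>J. \<omega> (i, j)))"
    by (rule iffD1[OF Q.indep_vars_iff_distr_eq_PiM'[OF I rv] indep])
  also have "\<dots> = (\<Pi>\<^sub>M i\<in>I. \<Pi>\<^sub>M j\<in>J. M)" by (intro PiM_cong refl block)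
  finally show ?thesis .
qed

lemma measurable_PiM_swap:
  "(\<lambda>\<omega>. \<lambda>j\<in>J. \<lambda>i\<in>I. \<omega> i j) \<in> measurable (\<Pi>\<^sub>M i\<in>I. \<Pi>\<^sub>M j\<in>J. M) (\<Pi>\<^sub>M j\<in>J. \<Pi>\<^sub>M i\<in>I. M)"
proof (intro measurable_restrict)
  fix i j assume "i \<in> I" "j \<in> J"
  then show "(\<lambda>\<omega>. \<omega> i j) \<in> measurable (\<Pi>\<^sub>M i\<in>I. \<Pi>\<^sub>M j\<in>J. M) M"
    by (intro measurable_compose[OF measurable_component_singleton[of i I] measurable_component_singleton]) auto
qed

lemma PiM_swap:
  assumes M: "prob_space M" and ne: "I \<noteq> {}" "J \<noteq> {}"
  shows "distr (\<Pi>\<^sub>M i\<in>I. \<Pi>\<^sub>M j\<in>J. M) (\<Pi>\<^sub>M j\<in>J. \<Pi>\<^sub>M i\<in>I. M) (\<lambda>\<omega>. \<lambda>j\<in>J. \<lambda>i\<in>I. \<omega> i j)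
    = (\<Pi>\<^sub>M j\<in>J. \<Pi>\<^sub>M i\<in>I. M)"
proof -
  let ?Q = "\<Pi>\<^sub>M p\<in>I \<times> J. M" and ?Q' = "\<Pi>\<^sub>M p\<in>J \<times> I. M"
  let ?IJ = "\<Pi>\<^sub>M i\<in>I. \<Pi>\<^sub>M j\<in>J. M" and ?JI = "\<Pi>\<^sub>M j\<in>J. \<Pi>\<^sub>M i\<in>I. M"
  let ?c = "\<lambda>\<omega>. \<lambda>i\<in>I. \<lambda>j\<in>J. \<omega> (i, j)" and ?c' = "\<lambda>\<omega>. \<lambda>j\<in>J. \<lambda>i\<in>I. \<omega> (j, i)"
  let ?s = "\<lambda>\<omega>. \<lambda>j\<in>J. \<lambda>i\<in>I. \<omega> i j" and ?r = "\<lambda>\<omega>. \<lambda>p\<in>J \<times> I. \<omega> (snd p, fst p)"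
  have mc: "?c \<in> measurable ?Q ?IJ" and mc': "?c' \<in> measurable ?Q' ?JI"
    and mr: "?r \<in> measurable ?Q ?Q'"
    by (auto intro!: measurable_restrict measurable_component_singleton)
  have ms: "?s \<in> measurable ?IJ ?JI" by (rule measurable_PiM_swap)
  have r: "distr ?Q ?Q' ?r = ?Q'"
    by (rule distr_PiM_reindex[of "I \<times> J" "\<lambda>_. M" "\<lambda>p. (snd p, fst p)" "J \<times> I"])
      (auto simp: M inj_on_def)
  have "distr ?IJ ?JI ?s = distr (distr ?Q ?IJ ?c) ?JI ?s"
    by (simp only: PiM_curry[OF M ne])
  also have "\<dots> = distr ?Q ?JI (?s \<circ> ?c)" by (rule distr_distr[OF ms mc])
  also have "?s \<circ> ?c = ?c' \<circ> ?r" by (auto simp: fun_eq_iff restrict_def)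
  also have "distr ?Q ?JI (?c' \<circ> ?r) = distr (distr ?Q ?Q' ?r) ?JI ?c'"
    by (rule distr_distr[OF mc' mr, symmetric])
  also have "\<dots> = ?JI" by (simp only: r PiM_curry[OF M ne(2,1)])
  finally show ?thesis .
qed

text \<open>Chebyshev's inequality; the mixed terms in the second moment of the sum vanish by independence.\<close>
lemma weak_law_of_large_numbers:
  fixes f :: "'a \<Rightarrow> real"
  assumes N: "prob_space N" and f: "integrable N f" "integrable N (\<lambda>x. (f x)\<^sup>2)" "(\<integral>x. f x \<partial>N) = 0"
    and n: "n > 0" and d: "\<delta> > 0"
  shows "measure (\<Pi>\<^sub>M k\<in>{..<n}. N) {\<omega> \<in> space (\<Pi>\<^sub>M k\<in>{..<n}. N). real n * \<delta> \<le> \<bar>\<Sum>k<n. f (\<omega> k)\<bar>}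
    \<le> (\<integral>x. (f x)\<^sup>2 \<partial>N) / (real n * \<delta>\<^sup>2)"
proof -
  let ?P = "\<Pi>\<^sub>M k\<in>{..<n}. N"
  let ?S = "\<lambda>\<omega>. \<Sum>k<n. f (\<omega> k)" and ?v = "\<integral>x. (f x)\<^sup>2 \<partial>N"
  interpret N: prob_space N by fact
  interpret P: prob_space ?P by (intro prob_space_PiM N)
  interpret X: product_sigma_finite "\<lambda>_. N" by (simp add: product_sigma_finite_def N.sigma_finite_measure_axioms)
  have pair: "integrable ?P (\<lambda>\<omega>. f (\<omega> j) * f (\<omega> k)) \<and>
    (\<integral>\<omega>. f (\<omega> j) * f (\<omega> k) \<partial>?P) = of_bool (j = k) * ?v" if jk: "j < n" "k < n" for j k
  proof -
    define g where "g i = (if j = k then if i = j then (\<lambda>x. (f x)\<^sup>2) else (\<lambda>_. 1)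
      else if i = j \<or> i = k then f else (\<lambda>_. 1))" for i
    have g: "integrable N (g i)" for i using f by (auto simp: g_def)
    have prod: "(\<Prod>i<n. g i (\<omega> i)) = f (\<omega> j) * f (\<omega> k)" for \<omega>
    proof -
      have "(\<Prod>i<n. g i (\<omega> i)) = (\<Prod>i\<in>{j, k}. g i (\<omega> i))"
        using jk by (intro prod.mono_neutral_right) (auto simp: g_def)
      then show ?thesis by (cases "j = k") (auto simp: g_def power2_eq_square)
    qed
    have "integrable ?P (\<lambda>\<omega>. \<Prod>i<n. g i (\<omega> i))"
      by (intro X.product_integrable_prod g) auto
    moreover have "(\<integral>\<omega>. (\<Prod>i<n. g i (\<omega> i)) \<partial>?P) = (\<Prod>i<n. \<integral>x. g i x \<partial>N)"
      by (intro X.product_integral_prod g) auto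
    moreover have "(\<Prod>i<n. \<integral>x. g i x \<partial>N) = (\<Prod>i\<in>{j, k}. \<integral>x. g i x \<partial>N)"
      using jk by (intro prod.mono_neutral_right) (auto simp: g_def N.prob_space)
    moreover have "\<dots> = of_bool (j = k) * ?v"
      using f by (cases "j = k") (auto simp: g_def)
    ultimately show ?thesis by (simp add: prod)
  qed
  have sq: "(?S \<omega>)\<^sup>2 = (\<Sum>j<n. \<Sum>k<n. f (\<omega> j) * f (\<omega> k))" for \<omega>
    by (simp add: power2_eq_square sum_product)
  have int: "integrable ?P (\<lambda>\<omega>. (?S \<omega>)\<^sup>2)"
    unfolding sq using pair by (intro Bochner_Integration.integrable_sum) auto
  have "(\<integral>\<omega>. (?S \<omega>)\<^sup>2 \<partial>?P) = (\<Sum>j<n. \<Sum>k<n. of_bool (j = k) * ?v)"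
  proof -
    have "(\<integral>\<omega>. (?S \<omega>)\<^sup>2 \<partial>?P) = (\<Sum>j<n. \<integral>\<omega>. (\<Sum>k<n. f (\<omega> j) * f (\<omega> k)) \<partial>?P)"
      unfolding sq using pair
      by (intro Bochner_Integration.integral_sum Bochner_Integration.integrable_sum) auto
    also have "\<dots> = (\<Sum>j<n. \<Sum>k<n. \<integral>\<omega>. f (\<omega> j) * f (\<omega> k) \<partial>?P)"
      using pair by (intro sum.cong refl Bochner_Integration.integral_sum) auto
    finally show ?thesis using pair by simp
  qed
  also have "\<dots> = real n * ?v" by (simp add: of_bool_def if_distribR if_distrib cong: if_cong)
  finally have second: "(\<integral>\<omega>. (?S \<omega>)\<^sup>2 \<partial>?P) = real n * ?v" .
  have [measurable]: "f \<in> borel_measurable N" using f by auto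
  have "measure ?P {\<omega> \<in> space ?P. real n * \<delta> \<le> \<bar>?S \<omega>\<bar>} \<le> (\<integral>\<omega>. (?S \<omega>)\<^sup>2 \<partial>?P) / (real n * \<delta>)\<^sup>2"
    using n d int by (intro P.second_moment_method) auto
  also have "\<dots> = ?v / (real n * \<delta>\<^sup>2)"
    unfolding second using n by (simp add: power2_eq_square)
  finally show ?thesis .
qed

section \<open>Gaussian integrals\<close>

definition std_gauss :: "real measure" where
  "std_gauss = density lborel (\<lambda>x. ennreal (std_normal_density x))"

lemma sets_std_gauss [measurable_cong, simp]: "sets std_gauss = sets borel"
  and space_std_gauss [simp]: "space std_gauss = UNIV"
  by (simp_all add: std_gauss_def)

lemma prob_space_std_gauss: "prob_space std_gauss"
  unfolding std_gauss_def by (rule prob_space_normal_density) simp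

lemma PiM_std_gauss:
  assumes "finite I"
  shows "(\<Pi>\<^sub>M i\<in>I. std_gauss)
    = density (\<Pi>\<^sub>M i\<in>I. lborel) (\<lambda>\<omega>. \<Prod>i\<in>I. ennreal (std_normal_density (\<omega> i)))"
  unfolding std_gauss_def
  by (rule PiM_density[OF assms])
    (auto simp: sigma_finite_lborel
      intro!: prob_space_imp_sigma_finite prob_space_std_gauss[unfolded std_gauss_def])

lemma nn_integral_gaussian:
  assumes d: "d > 0"
  shows "(\<integral>\<^sup>+y. ennreal (exp (- (d * y\<^sup>2) / 2)) \<partial>lborel) = ennreal (sqrt (2 * pi / d))"
proof -
  interpret prob_space "density lborel (\<lambda>x. ennreal (normal_density 0 (1 / sqrt d) x))"
    using d by (intro prob_space_normal_density) simp
  have "1 = (\<integral>\<^sup>+y. ennreal (normal_density 0 (1 / sqrt d) y) \<partial>lborel)"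
    using emeasure_space_1 by (simp add: emeasure_density)
  also have "\<dots> = (\<integral>\<^sup>+y. ennreal (1 / sqrt (2 * pi / d)) * ennreal (exp (- (d * y\<^sup>2) / 2)) \<partial>lborel)"
    using d by (intro nn_integral_cong)
      (simp add: normal_density_def power_divide field_simps ennreal_mult[symmetric])
  also have "\<dots> = ennreal (1 / sqrt (2 * pi / d)) * (\<integral>\<^sup>+y. ennreal (exp (- (d * y\<^sup>2) / 2)) \<partial>lborel)"
    by (intro nn_integral_cmult) measurable
  finally have "ennreal (sqrt (2 * pi / d)) * 1 = ennreal (sqrt (2 * pi / d)) * ennreal (1 / sqrt (2 * pi / d))
      * (\<integral>\<^sup>+y. ennreal (exp (- (d * y\<^sup>2) / 2)) \<partial>lborel)"
    by (simp add: mult.assoc)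
  moreover have "ennreal (sqrt (2 * pi / d)) * ennreal (1 / sqrt (2 * pi / d)) = 1"
    using d by (simp add: ennreal_mult[symmetric])
  ultimately show ?thesis by simp
qed

text \<open>By Fubini, only the integral over coordinate \<open>i\<close> matters, and for fixed other
coordinates the shear is a translation of it.\<close>
lemma nn_integral_PiM_shear:
  fixes i :: "'v::finite" and c :: "'v \<Rightarrow> real"
  assumes f [measurable]: "f \<in> borel_measurable (\<Pi>\<^sub>M i\<in>UNIV. (lborel :: real measure))"
  shows "(\<integral>\<^sup>+\<omega>. f \<omega> \<partial>(\<Pi>\<^sub>M i\<in>UNIV. lborel))
    = (\<integral>\<^sup>+\<omega>. f (fun_upd \<omega> i (\<omega> i + (\<Sum>l\<in>UNIV-{i}. c l * \<omega> l))) \<partial>(\<Pi>\<^sub>M i\<in>UNIV. lborel))"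
proof -
  interpret L: product_sigma_finite "\<lambda>_. lborel :: real measure"
    by (simp add: product_sigma_finite_def sigma_finite_lborel)
  let ?J = "UNIV - {i}" and ?L = "\<Pi>\<^sub>M i\<in>(UNIV::'v set). (lborel :: real measure)"
  let ?g = "\<lambda>\<omega>. f (fun_upd \<omega> i (\<omega> i + (\<Sum>l\<in>?J. c l * \<omega> l)))"
  have ins: "insert i ?J = UNIV" by auto
  have upd: "(\<lambda>\<omega>. fun_upd \<omega> i (\<omega> i + (\<Sum>l\<in>?J. c l * \<omega> l))) \<in> measurable ?L ?L"
    by (rule measurable_PiM_single') (auto simp: fun_upd_def)
  have g: "?g \<in> borel_measurable ?L" by (rule measurable_compose[OF upd f])
  have meas: "(\<lambda>y. fun_upd x i y) \<in> measurable lborel ?L" for x :: "'v \<Rightarrow> real"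
    by (rule measurable_PiM_single') (auto simp: fun_upd_def)
  have "(\<integral>\<^sup>+\<omega>. f \<omega> \<partial>?L) = (\<integral>\<^sup>+x. \<integral>\<^sup>+y. f (fun_upd x i y) \<partial>lborel \<partial>(\<Pi>\<^sub>M i\<in>?J. lborel))"
    using L.product_nn_integral_insert[of ?J i f] f by (simp add: ins)
  also have "\<dots> = (\<integral>\<^sup>+x. \<integral>\<^sup>+y. ?g (fun_upd x i y) \<partial>lborel \<partial>(\<Pi>\<^sub>M i\<in>?J. lborel))"
  proof (rule nn_integral_cong)
    fix x :: "'v \<Rightarrow> real"
    let ?s = "\<Sum>l\<in>?J. c l * x l"
    have "(\<lambda>y. f (fun_upd x i y)) \<in> borel_measurable borel"
      using measurable_compose[OF meas f] by simp
    then have "(\<integral>\<^sup>+y. f (fun_upd x i y) \<partial>lborel) = (\<integral>\<^sup>+y. f (fun_upd x i (?s + 1 * y)) \<partial>lborel)"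
      using nn_integral_real_affine[of "\<lambda>y. f (fun_upd x i y)" 1 ?s] by simp
    also have "\<dots> = (\<integral>\<^sup>+y. ?g (fun_upd x i y) \<partial>lborel)"
      by (intro nn_integral_cong arg_cong[where f = f]) (auto simp: fun_eq_iff intro!: sum.cong)
    finally show "(\<integral>\<^sup>+y. f (fun_upd x i y) \<partial>lborel) = (\<integral>\<^sup>+y. ?g (fun_upd x i y) \<partial>lborel)" .
  qed
  also have "\<dots> = (\<integral>\<^sup>+\<omega>. ?g \<omega> \<partial>?L)"
    using L.product_nn_integral_insert[of ?J i ?g] g by (simp add: ins)
  finally show ?thesis .
qed

lemma measurable_quad_form [measurable]:
  "(\<lambda>\<omega>. quad_form K (vec_lambda \<omega>)) \<in> borel_measurable (\<Pi>\<^sub>M i\<in>UNIV. (lborel :: real measure))"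
  unfolding quad_form_sum vec_lambda_beta by measurable

lemma nn_integral_exp_quad_form_congruence:
  fixes K :: "real^'v^'v"
  assumes "E \<in> shears"
  shows "(\<integral>\<^sup>+\<omega>. ennreal (exp (- quad_form (transpose E ** K ** E) (vec_lambda \<omega>) / 2)) \<partial>(\<Pi>\<^sub>M i\<in>UNIV. lborel))
    = (\<integral>\<^sup>+\<omega>. ennreal (exp (- quad_form K (vec_lambda \<omega>) / 2)) \<partial>(\<Pi>\<^sub>M i\<in>UNIV. lborel))"
  using assms
proof induction
  case one
  then show ?case by (simp add: transpose_mat)
next
  case (mult E i c)
  let ?I = "\<lambda>K. \<integral>\<^sup>+\<omega>. ennreal (exp (- quad_form K (vec_lambda \<omega>) / 2)) \<partial>(\<Pi>\<^sub>M i\<in>UNIV. lborel)"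
  have upd: "vec_lambda (fun_upd \<omega> i (\<omega> i + (\<Sum>l\<in>UNIV-{i}. c $ l * \<omega> l))) = shear i c *v vec_lambda \<omega>" for \<omega>
    by (auto simp: vec_eq_iff shear_mult)
  have "?I (transpose E ** K ** E) = (\<integral>\<^sup>+\<omega>. ennreal (exp (- quad_form (transpose E ** K ** E)
      (vec_lambda (fun_upd \<omega> i (\<omega> i + (\<Sum>l\<in>UNIV-{i}. c $ l * \<omega> l)))) / 2)) \<partial>(\<Pi>\<^sub>M i\<in>UNIV. lborel))"
    by (intro nn_integral_PiM_shear) measurable
  also have "\<dots> = ?I (transpose (shear i c) ** (transpose E ** K ** E) ** shear i c)"
    unfolding upd quad_form_congruence ..
  also have "\<dots> = ?I (transpose (E ** shear i c) ** K ** (E ** shear i c))"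
    by (simp add: matrix_transpose_mul matrix_mul_assoc)
  finally show ?case using mult.IH by simp
qed

text \<open>Shears change neither the integral nor the determinant, so it is enough to look at a diagonal
matrix, for which the integral is a product.\<close>
lemma gaussian_integral:
  fixes K :: "real^'v^'v"
  assumes K: "pos_def K"
  shows "(\<integral>\<^sup>+\<omega>. ennreal (exp (- quad_form K (vec_lambda \<omega>) / 2)) \<partial>(\<Pi>\<^sub>M i\<in>UNIV. lborel))
    = ennreal (sqrt (2 * pi) ^ CARD('v) / sqrt (det K))"
proof -
  interpret L: product_sigma_finite "\<lambda>_. lborel :: real measure"
    by (simp add: product_sigma_finite_def sigma_finite_lborel)
  obtain E where E: "E \<in> shears" "\<And>i j. i \<noteq> j \<Longrightarrow> (transpose E ** K ** E) $ i $ j = 0"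
    "\<And>i. (transpose E ** K ** E) $ i $ i \<le> K $ i $ i"
    using diagonalize_by_shears[OF K] by blast
  define D where "D = transpose E ** K ** E"
  have pd: "pos_def D" unfolding D_def using K det_shears[OF E(1)] by (simp add: pos_def_congruence)
  have Dpos: "0 < D $ i $ i" for i using pd by (rule pos_def_diag_pos)
  have det: "det K = (\<Prod>i\<in>UNIV. D $ i $ i)"
    using det_congruence_shears[OF E(1), of K] det_diagonal[of D] E(2) by (simp add: D_def)
  have qD: "quad_form D (vec_lambda \<omega>) = (\<Sum>i\<in>UNIV. D $ i $ i * (\<omega> i)\<^sup>2)" for \<omega>
    unfolding quad_form_sum
  proof (intro sum.cong refl)
    fix i
    have "(\<Sum>j\<in>UNIV. D $ i $ j * (vec_lambda \<omega> $ i * vec_lambda \<omega> $ j))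
      = (\<Sum>j\<in>UNIV. if j = i then D $ i $ i * (\<omega> i)\<^sup>2 else 0)"
      using E(2)[folded D_def] by (intro sum.cong) (auto simp: power2_eq_square)
    then show "(\<Sum>j\<in>UNIV. D $ i $ j * (vec_lambda \<omega> $ i * vec_lambda \<omega> $ j)) = D $ i $ i * (\<omega> i)\<^sup>2"
      by simp
  qed
  have "(\<integral>\<^sup>+\<omega>. ennreal (exp (- quad_form K (vec_lambda \<omega>) / 2)) \<partial>(\<Pi>\<^sub>M i\<in>UNIV. lborel))
    = (\<integral>\<^sup>+\<omega>. ennreal (exp (- quad_form D (vec_lambda \<omega>) / 2)) \<partial>(\<Pi>\<^sub>M i\<in>UNIV. lborel))"
    unfolding D_def by (rule nn_integral_exp_quad_form_congruence[OF E(1), symmetric])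
  also have "\<dots> = (\<integral>\<^sup>+\<omega>. (\<Prod>i\<in>UNIV. ennreal (exp (- (D $ i $ i * (\<omega> i)\<^sup>2) / 2))) \<partial>(\<Pi>\<^sub>M i\<in>UNIV. lborel))"
    unfolding qD by (intro nn_integral_cong)
      (simp add: prod_ennreal exp_sum[symmetric] sum_negf sum_divide_distrib)
  also have "\<dots> = (\<Prod>i\<in>UNIV. \<integral>\<^sup>+y. ennreal (exp (- (D $ i $ i * y\<^sup>2) / 2)) \<partial>lborel)"
    by (intro L.product_nn_integral_prod) auto
  also have "\<dots> = (\<Prod>i\<in>UNIV. ennreal (sqrt (2 * pi / D $ i $ i)))"
    by (intro prod.cong refl nn_integral_gaussian Dpos)
  also have "\<dots> = ennreal (\<Prod>i\<in>UNIV. sqrt (2 * pi) / sqrt (D $ i $ i))"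
    using Dpos by (simp add: prod_ennreal less_imp_le real_sqrt_divide)
  also have "(\<Prod>i\<in>UNIV. sqrt (2 * pi) / sqrt (D $ i $ i)) = sqrt (2 * pi) ^ CARD('v) / sqrt (det K)"
  proof -
    have "(\<Prod>i\<in>S. sqrt (D $ i $ i)) = sqrt (\<Prod>i\<in>S. D $ i $ i)" for S
      by (induction S rule: infinite_finite_induct) (simp_all add: real_sqrt_mult)
    then show ?thesis by (simp add: det prod_dividef)
  qed
  finally show ?thesis .
qed

text \<open>The factor \<open>exp (- |v|\<^sup>2 / 2)\<close> of the Gaussian density cancels the identity
matrix that is subtracted from \<open>K\<close>.\<close>
lemma laplace_transform_std_gauss:
  fixes K :: "real^'v^'v"
  assumes K: "pos_def K"
  shows "(\<integral>\<^sup>+\<omega>. ennreal (exp (- quad_form (K - mat 1) (vec_lambda \<omega>) / 2)) \<partial>(\<Pi>\<^sub>M i\<in>UNIV. std_gauss))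
    = ennreal (1 / sqrt (det K))"
proof -
  let ?L = "\<Pi>\<^sub>M i\<in>(UNIV::'v set). (lborel :: real measure)"
  let ?a = "sqrt (2 * pi) ^ CARD('v)"
  have one: "quad_form (mat 1) (vec_lambda \<omega>) = (\<Sum>i\<in>UNIV. (\<omega> i)\<^sup>2)" for \<omega> :: "'v \<Rightarrow> real"
    by (simp add: quad_form_def inner_vec_def power2_eq_square)
  have diff: "quad_form (K - mat 1) v = quad_form K v - quad_form (mat 1) v" for v
    by (simp add: quad_form_def matrix_vector_mult_diff_rdistrib inner_diff_right)
  have dens: "(\<Prod>i\<in>UNIV. ennreal (std_normal_density (\<omega> i))) * ennreal (exp (- quad_form (K - mat 1) (vec_lambda \<omega>) / 2))
    = ennreal (1 / ?a) * ennreal (exp (- quad_form K (vec_lambda \<omega>) / 2))" for \<omega> :: "'v \<Rightarrow> real"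
  proof -
    have "(\<Prod>i\<in>UNIV. std_normal_density (\<omega> i)) = 1 / ?a * exp (- quad_form (mat 1) (vec_lambda \<omega>) / 2)"
      by (simp add: std_normal_density_def prod.distrib prod_dividef exp_sum[symmetric] one sum_negf sum_divide_distrib)
    then have "(\<Prod>i\<in>UNIV. std_normal_density (\<omega> i)) * exp (- quad_form (K - mat 1) (vec_lambda \<omega>) / 2)
      = 1 / ?a * exp (- quad_form K (vec_lambda \<omega>) / 2)"
      by (simp add: diff exp_add[symmetric] diff_divide_distrib)
    then show ?thesis by (simp add: prod_ennreal ennreal_mult[symmetric] prod_nonneg)
  qed
  have "(\<integral>\<^sup>+\<omega>. ennreal (exp (- quad_form (K - mat 1) (vec_lambda \<omega>) / 2)) \<partial>(\<Pi>\<^sub>M i\<in>UNIV. std_gauss))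
    = (\<integral>\<^sup>+\<omega>. (\<Prod>i\<in>UNIV. ennreal (std_normal_density (\<omega> i))) * ennreal (exp (- quad_form (K - mat 1) (vec_lambda \<omega>) / 2)) \<partial>?L)"
    by (simp only: PiM_std_gauss[OF finite], intro nn_integral_density) measurable
  also have "\<dots> = ennreal (1 / ?a) * ennreal (?a / sqrt (det K))"
    unfolding dens gaussian_integral[OF K, symmetric] by (intro nn_integral_cmult) measurable
  also have "\<dots> = ennreal (1 / sqrt (det K))"
    using hadamard_inequality(1)[OF K] by (simp add: ennreal_mult[symmetric])
  finally show ?thesis .
qed

section \<open>The upper bound for the density of the graph\<close>

text \<open>A point of \<open>\<Pi>\<^sub>M k\<in>{..<n}. N\<close> for each vertex is the same thing as
\<open>n\<close> independent copies of a random vector indexed by the vertices. The second view is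
the one in which Chernoff bounds and the law of large numbers apply.\<close>
lemma kernel_density_swap:
  assumes N: "prob_space N" and V: "finite V" "V \<noteq> {}" and n: "n > 0"
    and A: "symmetric_kernel (\<Pi>\<^sub>M k\<in>{..<n}. N) A"
  shows "kernel_density V E (\<Pi>\<^sub>M k\<in>{..<n}. N) A = measure (\<Pi>\<^sub>M k\<in>{..<n}. \<Pi>\<^sub>M i\<in>V. N)
    {\<omega> \<in> space (\<Pi>\<^sub>M k\<in>{..<n}. \<Pi>\<^sub>M i\<in>V. N). \<forall>i\<in>V. \<forall>j\<in>V. {i, j} \<in> E \<longrightarrow>
      A (\<lambda>k\<in>{..<n}. \<omega> k i) (\<lambda>k\<in>{..<n}. \<omega> k j)}"
proof -
  interpret symmetric_kernel "\<Pi>\<^sub>M k\<in>{..<n}. N" A by fact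
  let ?P = "\<Pi>\<^sub>M k\<in>{..<n}. \<Pi>\<^sub>M i\<in>V. N" and ?Q = "\<Pi>\<^sub>M i\<in>V. \<Pi>\<^sub>M k\<in>{..<n}. N"
  let ?s = "\<lambda>\<omega>. \<lambda>i\<in>V. \<lambda>k\<in>{..<n}. \<omega> k i"
  let ?S = "{\<omega> \<in> space ?Q. \<forall>i\<in>V. \<forall>j\<in>V. {i, j} \<in> E \<longrightarrow> A (\<omega> i) (\<omega> j)}"
  have s: "?s \<in> measurable ?P ?Q" by (rule measurable_PiM_swap)
  have ne: "{..<n} \<noteq> {}" using n by auto
  have S: "?S \<in> sets ?Q" using V(1) by measurable
  have "kernel_density V E (\<Pi>\<^sub>M k\<in>{..<n}. N) A = measure (distr ?P ?Q ?s) ?S"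
    unfolding kernel_density_def PiM_swap[OF N ne V(2)] ..
  also have "\<dots> = measure ?P (?s -` ?S \<inter> space ?P)" by (rule measure_distr[OF s S])
  also have "?s -` ?S \<inter> space ?P = {\<omega> \<in> space ?P. \<forall>i\<in>V. \<forall>j\<in>V. {i, j} \<in> E \<longrightarrow>
      A (\<lambda>k\<in>{..<n}. \<omega> k i) (\<lambda>k\<in>{..<n}. \<omega> k j)}"
    using measurable_space[OF s] by auto
  finally show ?thesis .
qed

text \<open>The kernel of the proof: two Gaussian vectors in dimension \<open>n\<close> are adjacent if they
are, up to the error \<open>\<epsilon>\<close>, of length $\sqrt n$ and have the cosine
\<open>x\<close>.\<close>
definition gram_near :: "nat \<Rightarrow> real \<Rightarrow> real \<Rightarrow> (nat \<Rightarrow> real) \<Rightarrow> (nat \<Rightarrow> real) \<Rightarrow> bool" where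
  "gram_near n x \<epsilon> u v \<longleftrightarrow> \<bar>(\<Sum>k<n. u k * u k) - n\<bar> \<le> n * \<epsilon> \<and> \<bar>(\<Sum>k<n. v k * v k) - n\<bar> \<le> n * \<epsilon> \<and>
     \<bar>(\<Sum>k<n. u k * v k) - n * x\<bar> \<le> n * \<epsilon>"

lemma gram_near_restrict:
  "gram_near n x \<epsilon> (\<lambda>k\<in>{..<n}. u k) (\<lambda>k\<in>{..<n}. v k) = gram_near n x \<epsilon> u v"
  by (simp add: gram_near_def)

abbreviation gauss_space :: "nat \<Rightarrow> (nat \<Rightarrow> real) measure" where
  "gauss_space n \<equiv> \<Pi>\<^sub>M k\<in>{..<n}. std_gauss"

lemma symmetric_kernel_gram_near: "symmetric_kernel (gauss_space n) (gram_near n x \<epsilon>)"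
proof -
  have "prob_space (gauss_space n)" by (intro prob_space_PiM prob_space_std_gauss)
  moreover have "symp (gram_near n x \<epsilon>)" by (auto simp: symp_def gram_near_def mult.commute)
  moreover have "Measurable.pred (gauss_space n \<Otimes>\<^sub>M gauss_space n) (\<lambda>(u, v). gram_near n x \<epsilon> u v)"
  proof -
    have [measurable]: "(\<lambda>p. fst p k) \<in> borel_measurable (gauss_space n \<Otimes>\<^sub>M gauss_space n)"
      "(\<lambda>p. snd p k) \<in> borel_measurable (gauss_space n \<Otimes>\<^sub>M gauss_space n)" if "k \<in> {..<n}" for k
      using measurable_compose[OF measurable_fst measurable_component_singleton[OF that, of "\<lambda>_. std_gauss"]]
        measurable_compose[OF measurable_snd measurable_component_singleton[OF that, of "\<lambda>_. std_gauss"]]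
      by (simp_all add: measurable_cong_sets[OF refl sets_std_gauss])
    show ?thesis unfolding gram_near_def case_prod_beta by measurable
  qed
  ultimately show ?thesis by (simp add: symmetric_kernel_def symmetric_kernel_axioms_def)
qed

text \<open>The left-hand side is \<open>n\<close> times the pairing of \<open>K - mat 1\<close> with the
empirical Gram matrix. The pairing with \<open>M\<close> itself vanishes, as both
\<open>K ** M\<close> and \<open>M\<close> have trace \<open>CARD('v)\<close>. On the support of
\<open>K - mat 1\<close> the Gram matrix differs from \<open>M\<close> by at most
\<open>\<epsilon>\<close>: these are the edges and the vertices that lie on an edge, since
\<open>K $ i $ i = 1\<close> at an isolated vertex \<open>i\<close>.\<close>
lemma gram_quad_form_bound:
  fixes E :: "'v::finite set set"
  assumes G: "simple_graph UNIV E" and M: "M \<in> Psi E x" and KM: "K ** M = mat 1"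
    and sparse: "\<And>i j. i \<noteq> j \<Longrightarrow> {i, j} \<notin> E \<Longrightarrow> K $ i $ j = 0"
    and near: "\<And>i j. {i, j} \<in> E \<Longrightarrow> gram_near n x \<epsilon> (\<lambda>k. \<omega> k i) (\<lambda>k. \<omega> k j)"
  shows "(\<Sum>k<n. quad_form (K - mat 1) (vec_lambda (\<omega> k)))
    \<le> n * \<epsilon> * (\<Sum>i\<in>UNIV. \<Sum>j\<in>UNIV. \<bar>(K - mat 1) $ i $ j\<bar>)"
proof -
  define H where "H = K - mat 1"
  define S where "S i j = (\<Sum>k<n. \<omega> k i * \<omega> k j)" for i j
  have sym: "M $ i $ j = M $ j $ i" for i j using M by (auto simp: Psi_def intro: pos_def_sym)
  have entry: "H $ i $ j * (S i j - n * M $ i $ j) \<le> \<bar>H $ i $ j\<bar> * (n * \<epsilon>)" for i j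
  proof (cases "H $ i $ j = 0")
    case False
    have "\<bar>S i j - n * M $ i $ j\<bar> \<le> n * \<epsilon>"
    proof (cases "i = j")
      case True
      show ?thesis
      proof (cases "\<exists>k. {i, k} \<in> E")
        case True
        then show ?thesis using near[of i] \<open>i = j\<close> M by (auto simp: S_def gram_near_def Psi_def)
      next
        case no_edge: False
        have "(K ** M) $ i $ i = (\<Sum>k\<in>UNIV. if k = i then K $ i $ i * M $ i $ i else 0)"
          unfolding matrix_matrix_mult_def vec_lambda_beta
          using sparse[of i] no_edge by (intro sum.cong) auto
        then have "K $ i $ i = 1" using M by (simp add: KM mat_def Psi_def)
        then show ?thesis using False \<open>i = j\<close> by (simp add: H_def mat_def)
      qed
    next
      case ne: False
      then have "{i, j} \<in> E" using False sparse[of i j] by (auto simp: H_def mat_def)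
      then show ?thesis using near[of i j] M by (auto simp: S_def gram_near_def Psi_def)
    qed
    then have "\<bar>H $ i $ j\<bar> * \<bar>S i j - n * M $ i $ j\<bar> \<le> \<bar>H $ i $ j\<bar> * (n * \<epsilon>)"
      by (intro mult_left_mono) auto
    then show ?thesis unfolding abs_mult[symmetric] by linarith
  qed simp
  have zero: "(\<Sum>i\<in>UNIV. \<Sum>j\<in>UNIV. H $ i $ j * M $ i $ j) = 0"
  proof -
    have "(\<Sum>i\<in>UNIV. \<Sum>j\<in>UNIV. K $ i $ j * M $ i $ j) = trace (K ** M)"
      by (simp add: trace_def matrix_matrix_mult_def sym)
    moreover have "(\<Sum>j\<in>UNIV. mat 1 $ i $ j * M $ i $ j) = 1" for i
    proof -
      have "(\<Sum>j\<in>UNIV. mat 1 $ i $ j * M $ i $ j) = (\<Sum>j\<in>UNIV. if j = i then M $ i $ i else 0)"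
        by (intro sum.cong) (auto simp: mat_def)
      then show ?thesis using M by (simp add: Psi_def)
    qed
    ultimately show ?thesis
      by (simp add: H_def left_diff_distrib sum_subtractf KM trace_I)
  qed
  have "(\<Sum>k<n. quad_form H (vec_lambda (\<omega> k))) = (\<Sum>i\<in>UNIV. \<Sum>k<n. \<Sum>j\<in>UNIV. H $ i $ j * (\<omega> k i * \<omega> k j))"
    unfolding quad_form_sum vec_lambda_beta by (rule sum.swap)
  also have "\<dots> = (\<Sum>i\<in>UNIV. \<Sum>j\<in>UNIV. H $ i $ j * S i j)"
    unfolding S_def sum_distrib_left by (intro sum.cong refl sum.swap)
  also have "\<dots> = (\<Sum>i\<in>UNIV. \<Sum>j\<in>UNIV. H $ i $ j * S i j) - n * (\<Sum>i\<in>UNIV. \<Sum>j\<in>UNIV. H $ i $ j * M $ i $ j)"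
    using zero by simp
  also have "\<dots> = (\<Sum>i\<in>UNIV. \<Sum>j\<in>UNIV. H $ i $ j * (S i j - n * M $ i $ j))"
    by (simp add: sum_subtractf right_diff_distrib sum_distrib_left mult.left_commute)
  also have "\<dots> \<le> (\<Sum>i\<in>UNIV. \<Sum>j\<in>UNIV. \<bar>H $ i $ j\<bar> * (n * \<epsilon>))"
    by (intro sum_mono entry)
  also have "\<dots> = n * \<epsilon> * (\<Sum>i\<in>UNIV. \<Sum>j\<in>UNIV. \<bar>H $ i $ j\<bar>)"
    by (simp add: sum_distrib_left mult.commute)
  finally show ?thesis by (simp add: H_def)
qed

text \<open>Chernoff's bound. On the event in question
\<open>exp (- \<Sum>k<n. quad_form (K - mat 1) (vec_lambda (\<omega> k)) / 2)\<close> is at least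
\<open>exp (- n * \<epsilon> * C / 2)\<close>, while its expectation is
\<open>(1 / sqrt (det K)) ^ n\<close>.\<close>
lemma graph_density_upper_bound:
  fixes E :: "'v::finite set set"
  assumes G: "simple_graph UNIV E" and M: "M \<in> Psi E x" and K: "pos_def K" "K ** M = mat 1"
    and sparse: "\<And>i j. i \<noteq> j \<Longrightarrow> {i, j} \<notin> E \<Longrightarrow> K $ i $ j = 0"
    and n: "n > 0"
  defines "C \<equiv> \<Sum>i\<in>UNIV. \<Sum>j\<in>UNIV. \<bar>(K - mat 1) $ i $ j\<bar>"
  shows "kernel_density UNIV E (gauss_space n) (gram_near n x \<epsilon>) \<le> (exp (\<epsilon> * C / 2) / sqrt (det K)) ^ n"
proof -
  let ?\<Gamma> = "\<Pi>\<^sub>M i\<in>(UNIV::'v set). std_gauss" and ?H = "K - mat 1"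
  let ?P = "\<Pi>\<^sub>M k\<in>{..<n}. ?\<Gamma>"
  let ?h = "\<lambda>\<eta>. ennreal (exp (\<epsilon> * C / 2)) * ennreal (exp (- quad_form ?H (vec_lambda \<eta>) / 2))"
  interpret \<Gamma>: prob_space ?\<Gamma> by (intro prob_space_PiM prob_space_std_gauss)
  interpret P: prob_space ?P by (intro prob_space_PiM \<Gamma>.prob_space_axioms)
  interpret X: product_sigma_finite "\<lambda>_. ?\<Gamma>"
    by (simp add: product_sigma_finite_def \<Gamma>.sigma_finite_measure_axioms)
  define Ev where "Ev = {\<omega> \<in> space ?P. \<forall>i j. {i, j} \<in> E \<longrightarrow> gram_near n x \<epsilon> (\<lambda>k. \<omega> k i) (\<lambda>k. \<omega> k j)}"
  have kd: "kernel_density UNIV E (gauss_space n) (gram_near n x \<epsilon>) = measure ?P Ev"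
    using kernel_density_swap[OF prob_space_std_gauss _ _ n symmetric_kernel_gram_near, of "UNIV :: 'v set" E x \<epsilon>]
    unfolding gram_near_restrict Ev_def by simp
  have sets\<Gamma>: "sets ?\<Gamma> = sets (\<Pi>\<^sub>M i\<in>UNIV. lborel)" by (intro sets_PiM_cong) auto
  have q [measurable]: "(\<lambda>\<eta>. quad_form ?H (vec_lambda \<eta>)) \<in> borel_measurable ?\<Gamma>"
    using measurable_quad_form by (simp add: measurable_cong_sets[OF sets\<Gamma> refl])
  have le: "indicator Ev \<omega> \<le> (\<Prod>k<n. ?h (\<omega> k))" for \<omega>
  proof (cases "\<omega> \<in> Ev")
    case True
    then have "(\<Sum>k<n. quad_form ?H (vec_lambda (\<omega> k))) \<le> n * \<epsilon> * C"
      unfolding C_def Ev_def by (intro gram_quad_form_bound[OF G M K(2) sparse]) auto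
    then have "1 \<le> exp (\<Sum>k<n. \<epsilon> * C / 2 - quad_form ?H (vec_lambda (\<omega> k)) / 2)"
      by (simp add: sum_subtractf sum_divide_distrib[symmetric])
    also have "\<dots> = (\<Prod>k<n. exp (\<epsilon> * C / 2) * exp (- quad_form ?H (vec_lambda (\<omega> k)) / 2))"
      by (simp add: exp_sum exp_add[symmetric])
    finally have "ennreal 1 \<le> ennreal (\<Prod>k<n. exp (\<epsilon> * C / 2) * exp (- quad_form ?H (vec_lambda (\<omega> k)) / 2))"
      by (rule ennreal_leI)
    then show ?thesis using True by (simp add: prod_ennreal[symmetric] ennreal_mult)
  qed simp
  have "emeasure ?P Ev \<le> (\<integral>\<^sup>+\<omega>. indicator Ev \<omega> \<partial>?P)"
    by (cases "Ev \<in> sets ?P") (simp_all add: emeasure_notin_sets)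
  also have "\<dots> \<le> (\<integral>\<^sup>+\<omega>. (\<Prod>k<n. ?h (\<omega> k)) \<partial>?P)" by (intro nn_integral_mono le)
  also have "\<dots> = (\<Prod>k<n. \<integral>\<^sup>+\<eta>. ?h \<eta> \<partial>?\<Gamma>)" by (intro X.product_nn_integral_prod) auto
  also have "(\<integral>\<^sup>+\<eta>. ?h \<eta> \<partial>?\<Gamma>) = ennreal (exp (\<epsilon> * C / 2)) * ennreal (1 / sqrt (det K))"
    unfolding laplace_transform_std_gauss[OF K(1), symmetric] by (intro nn_integral_cmult) measurable
  also have "\<dots> = ennreal (exp (\<epsilon> * C / 2) / sqrt (det K))"
    using hadamard_inequality(1)[OF K(1)] by (simp add: ennreal_mult[symmetric])
  finally have "emeasure ?P Ev \<le> ennreal ((exp (\<epsilon> * C / 2) / sqrt (det K)) ^ n)"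
    using hadamard_inequality(1)[OF K(1)] by (simp add: ennreal_power)
  then show ?thesis
    using hadamard_inequality(1)[OF K(1)] unfolding kd P.emeasure_eq_measure by (subst (asm) ennreal_le_iff) auto
qed

section \<open>The lower bound for the density of the edge\<close>

text \<open>The pair is indexed by \<open>0\<close> and \<open>1\<close>, as in \<open>edge_density\<close>; the
index \<open>1\<close> must not be rewritten to \<open>Suc 0\<close>.\<close>
declare One_nat_def [simp del]

lemma integrable_std_gauss_power: "integrable std_gauss (\<lambda>u. u ^ k)"
  unfolding std_gauss_def
  by (subst integrable_density) (auto intro: integrable_std_normal_moment)

lemma integral_std_gauss: "(\<integral>u. u \<partial>std_gauss) = 0" "(\<integral>u. u\<^sup>2 \<partial>std_gauss) = 1"
  using integral_std_normal_moment_odd[of 0] integral_std_normal_moment_even[of 1]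
  by (simp_all add: std_gauss_def integral_density)

abbreviation gauss_pair :: "(nat \<Rightarrow> real) measure" where
  "gauss_pair \<equiv> \<Pi>\<^sub>M r\<in>{0, 1}. std_gauss"

lemma prob_space_gauss_pair: "prob_space gauss_pair"
  by (intro prob_space_PiM prob_space_std_gauss)

lemma gauss_pair_component:
  fixes g :: "real \<Rightarrow> real"
  assumes r: "r \<in> {0, 1}" and g: "integrable std_gauss g"
  shows "integrable gauss_pair (\<lambda>\<omega>. g (\<omega> r))" "(\<integral>\<omega>. g (\<omega> r) \<partial>gauss_pair) = (\<integral>u. g u \<partial>std_gauss)"
proof -
  have d: "distr gauss_pair std_gauss (\<lambda>\<omega>. \<omega> r) = std_gauss"
    by (rule distr_PiM_component[OF prob_space_std_gauss r])
  have m: "(\<lambda>\<omega>. \<omega> r) \<in> measurable gauss_pair std_gauss"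
    using r by (rule measurable_component_singleton)
  show "integrable gauss_pair (\<lambda>\<omega>. g (\<omega> r))"
    using integrable_distr[OF m, of g] g by (simp add: d)
  show "(\<integral>\<omega>. g (\<omega> r) \<partial>gauss_pair) = (\<integral>u. g u \<partial>std_gauss)"
    using integral_distr[OF m, of g] g by (simp add: d)
qed

lemma gauss_pair_moments:
  shows "r \<in> {0, 1} \<Longrightarrow> integrable gauss_pair (\<lambda>\<omega>. \<omega> r * \<omega> r - 1)"
    and "r \<in> {0, 1} \<Longrightarrow> integrable gauss_pair (\<lambda>\<omega>. (\<omega> r * \<omega> r - 1)\<^sup>2)"
    and "r \<in> {0, 1} \<Longrightarrow> (\<integral>\<omega>. \<omega> r * \<omega> r - 1 \<partial>gauss_pair) = 0"
    and "integrable gauss_pair (\<lambda>\<omega>. \<omega> 0 * \<omega> 1)"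
    and "integrable gauss_pair (\<lambda>\<omega>. (\<omega> 0 * \<omega> 1)\<^sup>2)"
    and "(\<integral>\<omega>. \<omega> 0 * \<omega> 1 \<partial>gauss_pair) = 0"
proof -
  interpret prob_space std_gauss by (rule prob_space_std_gauss)
  interpret X: product_sigma_finite "\<lambda>_. std_gauss"
    by (simp add: product_sigma_finite_def sigma_finite_measure_axioms)
  have i: "integrable std_gauss (\<lambda>u. u * u)" "integrable std_gauss (\<lambda>u. u)"
    using integrable_std_gauss_power[of 2] integrable_std_gauss_power[of 1] by (simp_all add: power2_eq_square)
  have sq: "(u * u - 1)\<^sup>2 = u ^ 4 - 2 * u ^ 2 + 1" for u :: real
    by (simp add: power2_eq_square power4_eq_xxxx algebra_simps)
  have i1: "integrable std_gauss (\<lambda>u. u * u - 1)" using i by simp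
  have i2: "integrable std_gauss (\<lambda>u. (u * u - 1)\<^sup>2)"
    unfolding sq by (intro Bochner_Integration.integrable_add Bochner_Integration.integrable_diff
        integrable_mult_right integrable_std_gauss_power) auto
  have e1: "(\<integral>u. u * u - 1 \<partial>std_gauss) = 0"
    using i integral_std_gauss(2) prob_space by (simp add: power2_eq_square)
  show "r \<in> {0, 1} \<Longrightarrow> integrable gauss_pair (\<lambda>\<omega>. \<omega> r * \<omega> r - 1)"
    and "r \<in> {0, 1} \<Longrightarrow> integrable gauss_pair (\<lambda>\<omega>. (\<omega> r * \<omega> r - 1)\<^sup>2)"
    and "r \<in> {0, 1} \<Longrightarrow> (\<integral>\<omega>. \<omega> r * \<omega> r - 1 \<partial>gauss_pair) = 0"
    using gauss_pair_component[OF _ i1] gauss_pair_component(1)[OF _ i2] e1 by auto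
  show "integrable gauss_pair (\<lambda>\<omega>. \<omega> 0 * \<omega> 1)"
    using X.product_integrable_prod[of "{0, 1::nat}" "\<lambda>_ u. u"] i by simp
  show "integrable gauss_pair (\<lambda>\<omega>. (\<omega> 0 * \<omega> 1)\<^sup>2)"
    using X.product_integrable_prod[of "{0, 1::nat}" "\<lambda>_ u. u\<^sup>2"] integrable_std_gauss_power[of 2]
    by (simp add: power_mult_distrib)
  show "(\<integral>\<omega>. \<omega> 0 * \<omega> 1 \<partial>gauss_pair) = 0"
    using X.product_integral_prod[of "{0, 1::nat}" "\<lambda>_ u. u"] i integral_std_gauss(1) by simp
qed

text \<open>Maps a pair of independent standard normal variables to a pair with correlation \<open>x\<close>.\<close>
definition correlate :: "real \<Rightarrow> (nat \<Rightarrow> real) \<Rightarrow> nat \<Rightarrow> real" where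
  "correlate x \<omega> = (\<lambda>r\<in>{0, 1}. if r = 0 then \<omega> 0 else x * \<omega> 0 + sqrt (1 - x\<^sup>2) * \<omega> 1)"

text \<open>The density of the law of a standard normal pair with correlation \<open>x\<close> relative to that
of an independent one.\<close>
definition tilt :: "real \<Rightarrow> (nat \<Rightarrow> real) \<Rightarrow> real" where
  "tilt x \<omega> = exp (- (x\<^sup>2 * (\<omega> 0 * \<omega> 0) - 2 * x * (\<omega> 0 * \<omega> 1) + x\<^sup>2 * (\<omega> 1 * \<omega> 1)) / (2 * (1 - x\<^sup>2))) / sqrt (1 - x\<^sup>2)"

lemma measurable_correlate [measurable]: "correlate x \<in> measurable gauss_pair gauss_pair"
proof -
  have "(\<lambda>\<omega>. \<lambda>r\<in>{0, 1}. if r = 0 then \<omega> 0 else x * \<omega> 0 + sqrt (1 - x\<^sup>2) * \<omega> 1) \<in> measurable gauss_pair gauss_pair"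
    by (intro measurable_restrict) (auto simp: measurable_cong_sets[OF refl sets_std_gauss])
  then show ?thesis by (simp add: correlate_def[abs_def])
qed

lemma measurable_tilt [measurable]: "tilt x \<in> borel_measurable gauss_pair"
  unfolding tilt_def[abs_def] by measurable

text \<open>The change of variables formula for \<open>v = x * u + sqrt (1 - x\<^sup>2) * z\<close>; the last
factor is \<open>tilt x\<close> at the pair \<open>(u, v)\<close>.\<close>
lemma std_normal_density_affine:
  assumes x: "\<bar>x\<bar> < 1"
  shows "sqrt (1 - x\<^sup>2) * (std_normal_density (x * u + sqrt (1 - x\<^sup>2) * z) *
    (exp (- (x\<^sup>2 * (u * u) - 2 * x * (u * (x * u + sqrt (1 - x\<^sup>2) * z))
      + x\<^sup>2 * ((x * u + sqrt (1 - x\<^sup>2) * z) * (x * u + sqrt (1 - x\<^sup>2) * z))) / (2 * (1 - x\<^sup>2))) / sqrt (1 - x\<^sup>2)))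
    = std_normal_density z"
proof -
  define s where "s = sqrt (1 - x\<^sup>2)"
  have "x\<^sup>2 < 1" using x by (simp add: abs_square_less_1)
  then have s: "s > 0" and s2: "s\<^sup>2 = 1 - x\<^sup>2" by (simp_all add: s_def)
  define v where "v = x * u + s * z"
  have "(x\<^sup>2 * (u * u) - 2 * x * (u * v) + x\<^sup>2 * (v * v)) = s\<^sup>2 * z\<^sup>2 - s\<^sup>2 * v\<^sup>2"
    unfolding s2 v_def using s2 by (simp add: power2_eq_square) algebra
  then have "- v\<^sup>2 / 2 + - (x\<^sup>2 * (u * u) - 2 * x * (u * v) + x\<^sup>2 * (v * v)) / (2 * s\<^sup>2) = - z\<^sup>2 / 2"
    using s by (simp add: field_simps)
  then have "exp (- v\<^sup>2 / 2) * exp (- (x\<^sup>2 * (u * u) - 2 * x * (u * v) + x\<^sup>2 * (v * v)) / (2 * s\<^sup>2)) = exp (- z\<^sup>2 / 2)"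
    by (simp only: exp_add[symmetric])
  then have "s * (std_normal_density v * (exp (- (x\<^sup>2 * (u * u) - 2 * x * (u * v) + x\<^sup>2 * (v * v)) / (2 * s\<^sup>2)) / s))
    = std_normal_density z"
    using s by (simp add: std_normal_density_def field_simps)
  then show ?thesis by (simp only: v_def s2) (simp only: s_def)
qed

lemma distr_correlate:
  assumes x: "\<bar>x\<bar> < 1"
  shows "distr gauss_pair gauss_pair (correlate x) = density gauss_pair (\<lambda>\<omega>. ennreal (tilt x \<omega>))"
proof (rule measure_eqI)
  fix A assume "A \<in> sets (distr gauss_pair gauss_pair (correlate x))"
  then have A [measurable]: "A \<in> sets gauss_pair" by simp
  interpret L: product_sigma_finite "\<lambda>_. lborel :: real measure"
    by (simp add: product_sigma_finite_def sigma_finite_lborel)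
  define s where "s = sqrt (1 - x\<^sup>2)"
  have "x\<^sup>2 < 1" using x by (simp add: abs_square_less_1)
  then have s: "s > 0" by (simp add: s_def)
  let ?L = "\<Pi>\<^sub>M r\<in>{0, 1::nat}. (lborel :: real measure)"
  let ?\<phi> = "\<lambda>u. ennreal (std_normal_density u)"
  have setsL: "sets ?L = sets gauss_pair" by (intro sets_PiM_cong) auto
  have expand: "(\<integral>\<^sup>+\<omega>. h \<omega> \<partial>gauss_pair) = (\<integral>\<^sup>+\<omega>'. \<integral>\<^sup>+y. ?\<phi> (\<omega>' 0) * ?\<phi> y * h (fun_upd \<omega>' 1 y) \<partial>lborel \<partial>(\<Pi>\<^sub>M r\<in>{0}. lborel))"
    if h [measurable]: "h \<in> borel_measurable gauss_pair" for h
  proof -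
    have [measurable]: "h \<in> borel_measurable ?L" using h by (simp add: measurable_cong_sets[OF setsL refl])
    have "(\<integral>\<^sup>+\<omega>. h \<omega> \<partial>gauss_pair) = (\<integral>\<^sup>+\<omega>. (\<Prod>r\<in>{0, 1}. ?\<phi> (\<omega> r)) * h \<omega> \<partial>?L)"
      by (subst PiM_std_gauss) (simp, intro nn_integral_density, measurable)
    also have "\<dots> = (\<integral>\<^sup>+\<omega>. ?\<phi> (\<omega> 0) * ?\<phi> (\<omega> 1) * h \<omega> \<partial>(\<Pi>\<^sub>M r\<in>insert 1 {0}. lborel))"
      by (simp add: insert_commute[of 1 0 "{}"])
    also have "\<dots> = (\<integral>\<^sup>+\<omega>'. \<integral>\<^sup>+y. ?\<phi> (\<omega>' 0) * ?\<phi> y * h (fun_upd \<omega>' 1 y) \<partial>lborel \<partial>(\<Pi>\<^sub>M r\<in>{0}. lborel))"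
    proof (subst L.product_nn_integral_insert)
      show "(\<lambda>\<omega>. ?\<phi> (\<omega> 0) * ?\<phi> (\<omega> 1) * h \<omega>) \<in> borel_measurable (\<Pi>\<^sub>M r\<in>insert 1 {0}. lborel)"
        unfolding insert_commute[of 1 0 "{}"] by measurable
    qed auto
    finally show ?thesis .
  qed
  have "emeasure (distr gauss_pair gauss_pair (correlate x)) A = (\<integral>\<^sup>+\<omega>. indicator A (correlate x \<omega>) \<partial>gauss_pair)"
    by (subst nn_integral_indicator[symmetric]) (simp, subst nn_integral_distr, simp_all)
  also have "\<dots> = (\<integral>\<^sup>+\<omega>'. \<integral>\<^sup>+y. ?\<phi> (\<omega>' 0) * ?\<phi> y * indicator A (correlate x (fun_upd \<omega>' 1 y)) \<partial>lborel \<partial>(\<Pi>\<^sub>M r\<in>{0}. lborel))"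
    by (rule expand) measurable
  also have "\<dots> = (\<integral>\<^sup>+\<omega>'. \<integral>\<^sup>+y. ?\<phi> (\<omega>' 0) * ?\<phi> y * (ennreal (tilt x (fun_upd \<omega>' 1 y)) * indicator A (fun_upd \<omega>' 1 y)) \<partial>lborel \<partial>(\<Pi>\<^sub>M r\<in>{0}. lborel))"
  proof (rule nn_integral_cong)
    fix \<omega>' assume w: "\<omega>' \<in> space (\<Pi>\<^sub>M r\<in>{0::nat}. (lborel :: real measure))"
    have upd [measurable]: "(\<lambda>y. fun_upd \<omega>' 1 y) \<in> measurable borel gauss_pair"
    proof (rule measurable_PiM_single')
      show "(\<lambda>y. fun_upd \<omega>' 1 y) \<in> space borel \<rightarrow> (\<Pi>\<^sub>E r\<in>{0, 1}. space std_gauss)"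
        using w by (auto simp: space_PiM PiE_iff extensional_def)
    qed (auto simp: fun_upd_def)
    have corr: "correlate x (fun_upd \<omega>' 1 z) = fun_upd \<omega>' 1 (x * \<omega>' 0 + s * z)" for z
      using w by (auto simp: correlate_def fun_eq_iff s_def space_PiM PiE_iff extensional_def)
    let ?k = "\<lambda>y. ?\<phi> (\<omega>' 0) * ?\<phi> y * (ennreal (tilt x (fun_upd \<omega>' 1 y)) * indicator A (fun_upd \<omega>' 1 y))"
    have "(\<integral>\<^sup>+y. ?k y \<partial>lborel) = ennreal s * (\<integral>\<^sup>+z. ?k (x * \<omega>' 0 + s * z) \<partial>lborel)"
      using s by (subst nn_integral_real_affine[of ?k s "x * \<omega>' 0"]) auto
    also have "\<dots> = (\<integral>\<^sup>+z. ennreal s * ?k (x * \<omega>' 0 + s * z) \<partial>lborel)"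
      by (rule nn_integral_cmult[symmetric]) measurable
    also have "\<dots> = (\<integral>\<^sup>+z. ?\<phi> (\<omega>' 0) * ?\<phi> z * indicator A (correlate x (fun_upd \<omega>' 1 z)) \<partial>lborel)"
    proof (rule nn_integral_cong)
      fix z
      let ?v = "x * \<omega>' 0 + s * z"
      have "s * (std_normal_density ?v * tilt x (fun_upd \<omega>' 1 ?v)) = std_normal_density z"
        using std_normal_density_affine[OF x, of "\<omega>' 0" z] by (simp add: tilt_def s_def)
      moreover have "0 \<le> tilt x (fun_upd \<omega>' 1 ?v)" using s by (simp add: tilt_def s_def)
      ultimately have "ennreal s * (?\<phi> ?v * ennreal (tilt x (fun_upd \<omega>' 1 ?v))) = ?\<phi> z"
        using s by (simp add: ennreal_mult[symmetric])
      then have "?\<phi> (\<omega>' 0) * (ennreal s * (?\<phi> ?v * ennreal (tilt x (fun_upd \<omega>' 1 ?v)))) * indicator A (fun_upd \<omega>' 1 ?v)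
        = ?\<phi> (\<omega>' 0) * ?\<phi> z * indicator A (fun_upd \<omega>' 1 ?v)" by simp
      then show "ennreal s * ?k ?v = ?\<phi> (\<omega>' 0) * ?\<phi> z * indicator A (correlate x (fun_upd \<omega>' 1 z))"
        unfolding corr by (simp add: mult_ac)
    qed
    finally show "(\<integral>\<^sup>+y. ?\<phi> (\<omega>' 0) * ?\<phi> y * indicator A (correlate x (fun_upd \<omega>' 1 y)) \<partial>lborel) = (\<integral>\<^sup>+y. ?k y \<partial>lborel)" by simp
  qed
  also have "\<dots> = (\<integral>\<^sup>+\<omega>. ennreal (tilt x \<omega>) * indicator A \<omega> \<partial>gauss_pair)"
    by (rule expand[symmetric]) measurable
  also have "\<dots> = emeasure (density gauss_pair (\<lambda>\<omega>. ennreal (tilt x \<omega>))) A"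
    by (simp add: emeasure_density)
  finally show "emeasure (distr gauss_pair gauss_pair (correlate x)) A
    = emeasure (density gauss_pair (\<lambda>\<omega>. ennreal (tilt x \<omega>))) A" .
qed simp

definition pair_near :: "nat \<Rightarrow> real \<Rightarrow> real \<Rightarrow> (nat \<Rightarrow> nat \<Rightarrow> real) set" where
  "pair_near n x \<epsilon> = {\<omega> \<in> space (\<Pi>\<^sub>M k\<in>{..<n}. gauss_pair). gram_near n x \<epsilon> (\<lambda>k. \<omega> k 0) (\<lambda>k. \<omega> k 1)}"

lemma sets_pair_near [measurable]: "pair_near n x \<epsilon> \<in> sets (\<Pi>\<^sub>M k\<in>{..<n}. gauss_pair)"
proof -
  have [measurable]: "(\<lambda>\<omega>. \<omega> k r) \<in> borel_measurable (\<Pi>\<^sub>M k\<in>{..<n}. gauss_pair)" if "k \<in> {..<n}" "r \<in> {0, 1}" for k r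
    using measurable_compose[OF measurable_component_singleton[OF that(1), of "\<lambda>_. gauss_pair"]
        measurable_component_singleton[OF that(2), of "\<lambda>_. std_gauss"]]
    by (simp add: measurable_cong_sets[OF refl sets_std_gauss])
  show ?thesis unfolding pair_near_def gram_near_def by measurable
qed

lemma edge_kernel_density:
  assumes n: "n > 0"
  shows "kernel_density {0, 1::nat} {{0, 1}} (gauss_space n) (gram_near n x \<epsilon>)
    = measure (\<Pi>\<^sub>M k\<in>{..<n}. gauss_pair) (pair_near n x \<epsilon>)"
proof -
  have comm: "gram_near n x \<epsilon> u v = gram_near n x \<epsilon> v u" for u v
    by (auto simp: gram_near_def mult.commute)
  have "(\<forall>i\<in>{0, 1}. \<forall>j\<in>{0, 1}. {i, j} \<in> {{0, 1::nat}} \<longrightarrow> gram_near n x \<epsilon> (\<lambda>k. \<omega> k i) (\<lambda>k. \<omega> k j))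
    \<longleftrightarrow> gram_near n x \<epsilon> (\<lambda>k. \<omega> k 0) (\<lambda>k. \<omega> k 1)" for \<omega> :: "nat \<Rightarrow> nat \<Rightarrow> real"
    using comm[of "\<lambda>k. \<omega> k 0" "\<lambda>k. \<omega> k 1"] by (auto simp: doubleton_eq_iff)
  then show ?thesis
    using kernel_density_swap[OF prob_space_std_gauss _ _ n symmetric_kernel_gram_near, of "{0, 1::nat}" "{{0, 1}}" x \<epsilon>]
    unfolding gram_near_restrict pair_near_def by simp
qed

text \<open>On \<open>pair_near\<close> the density of the correlated law is almost constant: with the exact
values \<open>1\<close>, \<open>x\<close> and \<open>1\<close> of the averages the exponent
$x^2 - 2x \cdot x + x^2$ vanishes, and the errors add up to at most $4\epsilon$.\<close>
lemma tilt_prod_bound: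
  assumes x: "\<bar>x\<bar> < 1" and \<omega>: "\<omega> \<in> pair_near n x \<epsilon>"
  shows "(\<Prod>k<n. tilt x (\<omega> k)) \<le> (exp (2 * \<epsilon> / (1 - x\<^sup>2)) / sqrt (1 - x\<^sup>2)) ^ n"
proof -
  have x2: "x\<^sup>2 < 1" using x by (simp add: abs_square_less_1)
  define a b c where "a = (\<Sum>k<n. \<omega> k 0 * \<omega> k 0)" and "b = (\<Sum>k<n. \<omega> k 0 * \<omega> k 1)" and "c = (\<Sum>k<n. \<omega> k 1 * \<omega> k 1)"
  have near: "\<bar>a - n\<bar> \<le> n * \<epsilon>" "\<bar>c - n\<bar> \<le> n * \<epsilon>" "\<bar>b - n * x\<bar> \<le> n * \<epsilon>"
    using \<omega> by (auto simp: pair_near_def gram_near_def a_def b_def c_def)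
  have ne: "0 \<le> n * \<epsilon>" using near(1) by linarith
  have small: "r * t \<le> n * \<epsilon>" if "\<bar>r\<bar> \<le> 1" "\<bar>t\<bar> \<le> n * \<epsilon>" for r t :: real
  proof -
    have "\<bar>r * t\<bar> \<le> n * \<epsilon>" using mult_mono[OF that] by (simp add: abs_mult)
    then show ?thesis by linarith
  qed
  have "x\<^sup>2 * (n - a) \<le> n * \<epsilon>" "x\<^sup>2 * (n - c) \<le> n * \<epsilon>" "x * (b - n * x) \<le> n * \<epsilon>"
    using near x x2 by (auto intro!: small simp: abs_minus_commute)
  then have le: "- (x\<^sup>2 * a - 2 * x * b + x\<^sup>2 * c) \<le> 4 * (n * \<epsilon>)"
    by (simp add: algebra_simps power2_eq_square)
  then have ex: "- (x\<^sup>2 * a - 2 * x * b + x\<^sup>2 * c) / (2 * (1 - x\<^sup>2)) \<le> n * (2 * \<epsilon> / (1 - x\<^sup>2))"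
  proof -
    have "- (x\<^sup>2 * a - 2 * x * b + x\<^sup>2 * c) / (2 * (1 - x\<^sup>2)) \<le> 4 * (n * \<epsilon>) / (2 * (1 - x\<^sup>2))"
      using x2 by (intro divide_right_mono le) simp
    also have "4 * (n * \<epsilon>) / (2 * d) = n * (2 * \<epsilon> / d)" for d :: real
      by (cases "d = 0") (simp_all add: field_simps)
    finally show ?thesis .
  qed
  have "(\<Prod>k<n. tilt x (\<omega> k)) = exp (- (x\<^sup>2 * a - 2 * x * b + x\<^sup>2 * c) / (2 * (1 - x\<^sup>2))) / sqrt (1 - x\<^sup>2) ^ n"
    by (simp add: tilt_def prod_dividef exp_sum[symmetric] a_def b_def c_def sum_distrib_left sum.distrib sum_subtractf
        sum_negf sum_divide_distrib[symmetric] del: mult_minus_left)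
  also have "\<dots> \<le> exp (n * (2 * \<epsilon> / (1 - x\<^sup>2))) / sqrt (1 - x\<^sup>2) ^ n"
    using x2 ex by (intro divide_right_mono) auto
  finally show ?thesis by (simp only: power_divide exp_of_nat_mult)
qed

text \<open>Change of measure. Under the correlated law the event \<open>pair_near\<close> is typical, by the
law of large numbers, and on this event the density of the correlated law is at most
\<open>(exp (2 * \<epsilon> / (1 - x\<^sup>2)) / sqrt (1 - x\<^sup>2)) ^ n\<close>. So under the
independent law the event has at least the inverse of that number as its probability, up to the
factor one half.\<close>
lemma edge_density_lower_bound:
  assumes x: "\<bar>x\<bar> < 1" and e: "\<epsilon> > 0"
  obtains n0 where "n0 > 0" "\<And>n. n \<ge> n0 \<Longrightarrow>
    1 / 2 * (sqrt (1 - x\<^sup>2) * exp (- (2 * \<epsilon> / (1 - x\<^sup>2)))) ^ n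
      \<le> kernel_density {0, 1::nat} {{0, 1}} (gauss_space n) (gram_near n x \<epsilon>)"
proof -
  have x2: "x\<^sup>2 < 1" using x by (simp add: abs_square_less_1)
  define s where "s = sqrt (1 - x\<^sup>2)"
  have s: "s > 0" "s \<le> 1" "s * s = 1 - x\<^sup>2" using x2 by (simp_all add: s_def)
  \<comment> \<open>Each entry of the Gram matrix of the correlated vectors collects at most four deviations of size \<open>\<delta>\<close>.\<close>
  define \<delta> where "\<delta> = \<epsilon> / 4"
  have d: "\<delta> > 0" using e by (simp add: \<delta>_def)
  define f1 f2 f3 :: "(nat \<Rightarrow> real) \<Rightarrow> real" where "f1 = (\<lambda>\<omega>. \<omega> 0 * \<omega> 0 - 1)"
    and "f2 = (\<lambda>\<omega>. \<omega> 0 * \<omega> 1)" and "f3 = (\<lambda>\<omega>. \<omega> 1 * \<omega> 1 - 1)"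
  define v where "v f = (\<integral>\<omega>. (f \<omega>)\<^sup>2 \<partial>gauss_pair)" for f :: "(nat \<Rightarrow> real) \<Rightarrow> real"
  \<comment> \<open>From this dimension on the three Chebyshev bounds add up to at most one half.\<close>
  define n0 where "n0 = Suc (nat \<lceil>2 * (v f1 + v f2 + v f3) / \<delta>\<^sup>2\<rceil>)"
  have main: "1 / 2 * (s * exp (- (2 * \<epsilon> / (1 - x\<^sup>2)))) ^ n
      \<le> kernel_density {0, 1::nat} {{0, 1}} (gauss_space n) (gram_near n x \<epsilon>)" if n: "n \<ge> n0" for n
  proof -
    have n_pos: "n > 0" using n by (simp add: n0_def)
    let ?P = "\<Pi>\<^sub>M k\<in>{..<n}. gauss_pair"
    interpret \<Gamma>: prob_space gauss_pair by (rule prob_space_gauss_pair)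
    interpret P: prob_space ?P by (intro prob_space_PiM prob_space_gauss_pair)
    let ?B = "\<lambda>f. {\<omega> \<in> space ?P. real n * \<delta> \<le> \<bar>\<Sum>k<n. f (\<omega> k)\<bar>}"
    let ?T = "compose {..<n} (correlate x)"
    let ?c = "(exp (2 * \<epsilon> / (1 - x\<^sup>2)) / s) ^ n"
    have T [measurable]: "?T \<in> measurable ?P ?P"
      unfolding compose_def by (intro measurable_restrict) measurable
    have m: "f1 \<in> borel_measurable gauss_pair" "f2 \<in> borel_measurable gauss_pair" "f3 \<in> borel_measurable gauss_pair"
      unfolding f1_def f2_def f3_def by measurable
    have B_sets: "?B f \<in> sets ?P" if [measurable]: "f \<in> borel_measurable gauss_pair" for f
      by measurable
    have wl: "P.prob (?B f1) \<le> v f1 / (n * \<delta>\<^sup>2)" "P.prob (?B f2) \<le> v f2 / (n * \<delta>\<^sup>2)" "P.prob (?B f3) \<le> v f3 / (n * \<delta>\<^sup>2)"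
      unfolding v_def f1_def f2_def f3_def
      by (intro weak_law_of_large_numbers prob_space_gauss_pair gauss_pair_moments n_pos d; simp)+
    have "P.prob (?B f1 \<union> ?B f2 \<union> ?B f3) \<le> P.prob (?B f1) + P.prob (?B f2) + P.prob (?B f3)"
      using B_sets m by (intro order_trans[OF measure_Un_le] add_right_mono measure_Un_le sets.Un) auto
    also have "\<dots> \<le> (v f1 + v f2 + v f3) / (n * \<delta>\<^sup>2)" using wl by (simp add: add_divide_distrib)
    also have "\<dots> \<le> 1 / 2"
    proof -
      have "2 * (v f1 + v f2 + v f3) / \<delta>\<^sup>2 \<le> n" using n unfolding n0_def by linarith
      then show ?thesis using d n_pos by (simp add: field_simps)
    qed
    finally have bad: "P.prob (?B f1 \<union> ?B f2 \<union> ?B f3) \<le> 1 / 2" .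
    have sub: "space ?P - (?B f1 \<union> ?B f2 \<union> ?B f3) \<subseteq> ?T -` pair_near n x \<epsilon> \<inter> space ?P"
    proof
      fix \<omega> assume w: "\<omega> \<in> space ?P - (?B f1 \<union> ?B f2 \<union> ?B f3)"
      define a b c where "a = (\<Sum>k<n. \<omega> k 0 * \<omega> k 0) - n" and "b = (\<Sum>k<n. \<omega> k 0 * \<omega> k 1)"
        and "c = (\<Sum>k<n. \<omega> k 1 * \<omega> k 1) - n"
      have abc: "\<bar>a\<bar> \<le> n * \<delta>" "\<bar>b\<bar> \<le> n * \<delta>" "\<bar>c\<bar> \<le> n * \<delta>"
        using w by (auto simp: f1_def f2_def f3_def a_def b_def c_def sum_subtractf)
      have small: "\<bar>r * t\<bar> \<le> n * \<delta>" if "\<bar>r\<bar> \<le> 1" "\<bar>t\<bar> \<le> n * \<delta>" for r t :: real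
        using mult_mono[OF that] by (simp add: abs_mult)
      have T0: "?T \<omega> k 0 = \<omega> k 0" and T1: "?T \<omega> k 1 = x * \<omega> k 0 + s * \<omega> k 1" if "k < n" for k
        using that by (simp_all add: compose_def correlate_def s_def)
      have S00: "(\<Sum>k<n. ?T \<omega> k 0 * ?T \<omega> k 0) - n = a" by (simp add: T0 a_def)
      have S01: "(\<Sum>k<n. ?T \<omega> k 0 * ?T \<omega> k 1) - n * x = x * a + s * b"
        by (simp add: T0 T1 a_def b_def algebra_simps sum.distrib sum_distrib_left)
      have S11: "(\<Sum>k<n. ?T \<omega> k 1 * ?T \<omega> k 1) - n = x\<^sup>2 * a + 2 * ((x * s) * b) + s\<^sup>2 * c"
      proof -
        have "(\<Sum>k<n. ?T \<omega> k 1 * ?T \<omega> k 1) = x\<^sup>2 * (a + n) + 2 * ((x * s) * b) + s\<^sup>2 * (c + n)"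
          by (simp add: T1 a_def b_def c_def sum_distrib_left sum.distrib[symmetric] power2_eq_square algebra_simps)
        moreover have "x\<^sup>2 * n + s\<^sup>2 * n = n" using s(3)
          by (simp add: power2_eq_square distrib_right[symmetric])
        ultimately show ?thesis by (simp add: algebra_simps)
      qed
      have "\<bar>x * s\<bar> \<le> 1" "\<bar>x\<^sup>2\<bar> \<le> 1" "\<bar>s\<^sup>2\<bar> \<le> 1" "\<bar>s\<bar> \<le> 1" "\<bar>x\<bar> \<le> 1"
        using x s x2 by (auto simp: abs_mult power_le_one intro: mult_le_one)
      note sm = small[OF this(1) abc(2)] small[OF this(2) abc(1)] small[OF this(3) abc(3)]
        small[OF this(4) abc(2)] small[OF this(5) abc(1)]
      have add1: "\<bar>p\<bar> \<le> 4 * m" if "\<bar>p\<bar> \<le> m" for p m :: real using that by linarith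
      have add2: "\<bar>p + q\<bar> \<le> 4 * m" if "\<bar>p\<bar> \<le> m" "\<bar>q\<bar> \<le> m" for p q m :: real using that by linarith
      have add3: "\<bar>p + 2 * q + r\<bar> \<le> 4 * m" if "\<bar>p\<bar> \<le> m" "\<bar>q\<bar> \<le> m" "\<bar>r\<bar> \<le> m" for p q r m :: real
        using that by linarith
      have ed: "n * \<epsilon> = 4 * (n * \<delta>)" by (simp add: \<delta>_def)
      have "gram_near n x \<epsilon> (\<lambda>k. ?T \<omega> k 0) (\<lambda>k. ?T \<omega> k 1)"
        unfolding gram_near_def S00 S01 S11 ed
        using add1[OF abc(1)] add3[OF sm(2,1,3)] add2[OF sm(5,4)] by blast
      then show "\<omega> \<in> ?T -` pair_near n x \<epsilon> \<inter> space ?P"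
        using w measurable_space[OF T] by (auto simp: pair_near_def)
    qed
    have "1 / 2 \<le> P.prob (space ?P - (?B f1 \<union> ?B f2 \<union> ?B f3))"
      using bad B_sets m by (subst P.prob_compl) auto
    also have "\<dots> \<le> P.prob (?T -` pair_near n x \<epsilon> \<inter> space ?P)"
      by (intro P.finite_measure_mono sub) measurable
    finally have half: "1 / 2 \<le> P.prob (?T -` pair_near n x \<epsilon> \<inter> space ?P)" .
    have D: "sigma_finite_measure (density gauss_pair (\<lambda>\<omega>. ennreal (tilt x \<omega>)))"
      using \<Gamma>.prob_space_distr[OF measurable_correlate[of x]] distr_correlate[OF x]
      by (simp add: prob_space_imp_sigma_finite)
    have "distr ?P ?P ?T = (\<Pi>\<^sub>M k\<in>{..<n}. distr gauss_pair gauss_pair (correlate x))"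
      by (rule distr_PiM_finite_prob_space') (auto simp: prob_space_gauss_pair)
    also have "\<dots> = density ?P (\<lambda>\<omega>. \<Prod>k<n. ennreal (tilt x (\<omega> k)))"
      unfolding distr_correlate[OF x]
      by (rule PiM_density) (auto simp: \<Gamma>.sigma_finite_measure_axioms D)
    finally have law: "distr ?P ?P ?T = density ?P (\<lambda>\<omega>. \<Prod>k<n. ennreal (tilt x (\<omega> k)))" .
    have "emeasure ?P (?T -` pair_near n x \<epsilon> \<inter> space ?P) = emeasure (distr ?P ?P ?T) (pair_near n x \<epsilon>)"
      by (rule emeasure_distr[symmetric]) measurable
    also have "\<dots> = (\<integral>\<^sup>+\<omega>. (\<Prod>k<n. ennreal (tilt x (\<omega> k))) * indicator (pair_near n x \<epsilon>) \<omega> \<partial>?P)"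
      unfolding law by (rule emeasure_density) measurable
    also have "\<dots> \<le> (\<integral>\<^sup>+\<omega>. ennreal ?c * indicator (pair_near n x \<epsilon>) \<omega> \<partial>?P)"
    proof (rule nn_integral_mono)
      fix \<omega> :: "nat \<Rightarrow> nat \<Rightarrow> real"
      have "0 \<le> tilt x (\<omega> k)" for k using x2 by (simp add: tilt_def)
      then have "(\<Prod>k<n. ennreal (tilt x (\<omega> k))) \<le> ennreal ?c" if "\<omega> \<in> pair_near n x \<epsilon>"
        using tilt_prod_bound[OF x that] by (simp add: prod_ennreal s_def ennreal_leI)
      then show "(\<Prod>k<n. ennreal (tilt x (\<omega> k))) * indicator (pair_near n x \<epsilon>) \<omega>
        \<le> ennreal ?c * indicator (pair_near n x \<epsilon>) \<omega>"
        by (auto simp: indicator_def)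
    qed
    also have "\<dots> = ennreal ?c * emeasure ?P (pair_near n x \<epsilon>)"
      by (rule nn_integral_cmult_indicator) measurable
    finally have "P.prob (?T -` pair_near n x \<epsilon> \<inter> space ?P) \<le> ?c * P.prob (pair_near n x \<epsilon>)"
      using s by (simp add: P.emeasure_eq_measure ennreal_mult[symmetric])
    with half have "1 / 2 \<le> ?c * P.prob (pair_near n x \<epsilon>)" by linarith
    then have "1 / 2 / ?c \<le> P.prob (pair_near n x \<epsilon>)" using s by (simp add: field_simps)
    moreover have "1 / 2 / ?c = 1 / 2 * (s * exp (- (2 * \<epsilon> / (1 - x\<^sup>2)))) ^ n"
      by (simp add: power_divide power_mult_distrib exp_minus field_simps)
    ultimately show ?thesis unfolding edge_kernel_density[OF n_pos] by simp
  qed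
  show thesis by (rule that[of n0]) (use main in \<open>simp_all add: n0_def s_def\<close>)
qed

section \<open>The determinant inequality\<close>

text \<open>With a single edge as target, the Sidorenko inequality gives a homomorphism into the edge, that is,
a bipartition. Let $\sigma$ be one on one side and the sign of \<open>x\<close> on the other; then
$(1-|x|) I + |x| \sigma\sigma^T$ belongs to \<open>Psi\<close>.\<close>
lemma Psi_nonempty_of_sidorenko:
  fixes E :: "'v::finite set set"
  assumes S: "sidorenko (UNIV :: 'v set) E" and G: "simple_graph UNIV E" and x: "x \<in> {-1<..<1}"
  shows "Psi E x \<noteq> {}"
proof -
  let ?W = "{0, 1::nat}" and ?F = "{{0, 1::nat}}"
  have fin: "finite (V \<rightarrow>\<^sub>E ?W)" "V \<rightarrow>\<^sub>E ?W \<noteq> {}" if "finite V" for V :: "'w set"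
    using that by (auto intro: finite_PiE simp: PiE_eq_empty_iff)
  let ?S = "(?W \<rightarrow>\<^sub>E ?W) \<inter> {f. \<forall>e\<in>?F. f ` e \<in> ?F}"
  have mem: "(\<lambda>r\<in>?W. r) \<in> ?S" by auto
  have S_ne: "?S \<noteq> {}" by (rule ex_in_conv[THEN iffD1, OF exI, OF mem])
  have S_fin: "finite ?S" using fin(1)[of ?W] by simp
  have "card ?S > 0" by (rule card_gt_0_iff[THEN iffD2, OF conjI, OF S_ne S_fin])
  moreover have W: "?W \<rightarrow>\<^sub>E ?W \<noteq> {}" "finite (?W \<rightarrow>\<^sub>E ?W)" by (rule fin; simp)+
  then have "card (?W \<rightarrow>\<^sub>E ?W) > 0" by (simp only: card_gt_0_iff simp_thms)
  ultimately have "edge_density ?W ?F > 0"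
    unfolding hom_density_def measure_pmf_of_set[OF W]
    by (intro divide_pos_pos) (simp_all only: of_nat_0_less_iff)
  then have "0 < edge_density ?W ?F ^ card E" by (rule zero_less_power)
  also have "\<dots> \<le> hom_density (UNIV :: 'v set) E ?W ?F"
    by (rule S[unfolded sidorenko_def, rule_format]) (simp add: simple_graph_def)
  finally have "(UNIV \<rightarrow>\<^sub>E ?W) \<inter> {f. \<forall>e\<in>E. f ` e \<in> ?F} \<noteq> {}"
    unfolding hom_density_def using fin[of "UNIV :: 'v set"] by (auto simp: measure_pmf_of_set)
  then obtain f where "\<forall>e\<in>E. f ` e \<in> ?F" by blast
  then have f: "f ` e = {0, 1}" if "e \<in> E" for e using that by simp
  define \<sigma> where "\<sigma> i = (if f i = 0 then 1 else sgn x)" for i :: 'v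
  define M :: "real^'v^'v" where "M = (\<chi> i j. (1 - \<bar>x\<bar>) * of_bool (i = j) + \<bar>x\<bar> * (\<sigma> i * \<sigma> j))"
  have "pos_def M"
    unfolding pos_def_quad_form
  proof (intro conjI allI impI)
    show "transpose M = M" by (auto simp: M_def transpose_def vec_eq_iff)
    fix v :: "real^'v" assume v: "v \<noteq> 0"
    have "quad_form M v = (\<Sum>i\<in>UNIV. \<Sum>j\<in>UNIV. (if j = i then (1 - \<bar>x\<bar>) * (v $ i * v $ i) else 0)
        + \<bar>x\<bar> * ((\<sigma> i * v $ i) * (\<sigma> j * v $ j)))"
      unfolding quad_form_sum by (intro sum.cong refl) (auto simp: M_def algebra_simps)
    also have "\<dots> = (1 - \<bar>x\<bar>) * (v \<bullet> v) + \<bar>x\<bar> * (\<Sum>i\<in>UNIV. \<sigma> i * v $ i)\<^sup>2"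
      by (simp add: sum.distrib inner_vec_def sum_distrib_left[symmetric] sum_distrib_right[symmetric] power2_eq_square)
    also have "\<dots> > 0" using x v by (intro add_pos_nonneg mult_pos_pos) auto
    finally show "quad_form M v > 0" .
  qed
  moreover have "M $ i $ i = 1" for i by (auto simp: M_def \<sigma>_def abs_if sgn_if)
  moreover have "M $ i $ j = x" if "{i, j} \<in> E" for i j
  proof -
    have "{f i, f j} = {0, 1}" using f[OF that] by simp
    then have ends: "f i = 0 \<and> f j = 1 \<or> f i = 1 \<and> f j = 0" by (simp add: doubleton_eq_iff)
    then have "i \<noteq> j" by auto
    with ends show ?thesis by (auto simp: M_def \<sigma>_def abs_if sgn_if)
  qed
  ultimately have "M \<in> Psi E x" by (simp add: Psi_def)
  then show ?thesis by blast
qed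

lemma exponential_growth_le:
  fixes a b c :: real
  assumes c: "c > 0" and a: "a > 0" and le: "\<And>n. n \<ge> n0 \<Longrightarrow> c * b ^ n \<le> a ^ n"
  shows "b \<le> a"
proof (rule ccontr)
  assume "\<not> b \<le> a"
  then have q: "1 < b / a" using a by simp
  then obtain m where m: "1 / c < (b / a) ^ m" using real_arch_pow by blast
  also have "\<dots> \<le> (b / a) ^ max m n0" using q by (intro power_increasing) auto
  finally have "a ^ max m n0 < c * b ^ max m n0"
    using a c by (simp add: power_divide field_simps)
  then show False using le[of "max m n0"] by simp
qed

theorem theorem1p4:
  fixes E :: "'v::finite set set" and x :: real
  assumes "simple_graph (UNIV :: 'v set) E"
    and "sidorenko (UNIV :: 'v set) E"
    and "x \<in> {-1<..<1}"
  shows "tau E x \<ge> (1 - x\<^sup>2) ^ card E"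
proof -
  have x: "\<bar>x\<bar> < 1" and x2: "x\<^sup>2 < 1" using assms(3) by (auto simp: abs_square_less_1)
  obtain M K where MK: "M \<in> Psi E x" "pos_def K" "K ** M = mat 1" "det K * tau E x = 1"
    and sparse: "\<And>i j. i \<noteq> j \<Longrightarrow> {i, j} \<notin> E \<Longrightarrow> K $ i $ j = 0"
    using tau_dual_matrix[OF Psi_nonempty_of_sidorenko[OF assms(2,1,3)]] by blast
  have detK: "det K > 0" by (rule hadamard_inequality(1)[OF MK(2)])
  define C where "C = (\<Sum>i\<in>UNIV. \<Sum>j\<in>UNIV. \<bar>(K - mat 1) $ i $ j\<bar>)"
  define m where "m = card E"
  define s where "s = sqrt (1 - x\<^sup>2)"
  have approx: "(s * exp (- (2 * \<epsilon> / (1 - x\<^sup>2)))) ^ m \<le> exp (\<epsilon> * C / 2) / sqrt (det K)"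
    if e: "\<epsilon> > 0" for \<epsilon>
  proof -
    let ?b = "s * exp (- (2 * \<epsilon> / (1 - x\<^sup>2)))" and ?a = "exp (\<epsilon> * C / 2) / sqrt (det K)"
    obtain n0 where n0: "n0 > 0" "\<And>n. n \<ge> n0 \<Longrightarrow> 1 / 2 * ?b ^ n
        \<le> kernel_density {0, 1::nat} {{0, 1}} (gauss_space n) (gram_near n x \<epsilon>)"
      using edge_density_lower_bound[OF x e] unfolding s_def by metis
    \<comment> \<open>Comparing the exponential rates in the dimension \<open>n\<close> removes the factor \<open>(1 / 2) ^ m\<close>.\<close>
    show ?thesis
    proof (rule exponential_growth_le)
      show "(1 / 2 :: real) ^ m > 0" by simp
      show "?a > 0" using detK by simp
      fix n assume n: "n \<ge> n0"
      interpret symmetric_kernel "gauss_space n" "gram_near n x \<epsilon>" by (rule symmetric_kernel_gram_near)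
      have "(1 / 2) ^ m * (?b ^ m) ^ n = (1 / 2 * ?b ^ n) ^ m"
        by (simp only: power_mult_distrib power_mult[symmetric] mult.commute)
      also have "\<dots> \<le> kernel_density {0, 1::nat} {{0, 1}} (gauss_space n) (gram_near n x \<epsilon>) ^ m"
        using n0(2)[OF n] x2 by (intro power_mono) (simp_all add: s_def)
      also have "\<dots> \<le> kernel_density UNIV E (gauss_space n) (gram_near n x \<epsilon>)"
        unfolding m_def by (rule sidorenko_kernel[OF assms(1,2)])
      also have "\<dots> \<le> ?a ^ n"
        unfolding C_def using n n0(1)
        by (intro graph_density_upper_bound[OF assms(1) MK(1-3) sparse]) auto
      finally show "(1 / 2) ^ m * (?b ^ m) ^ n \<le> ?a ^ n" .
    qed
  qed
  \<comment> \<open>The limit \<open>\<epsilon> \<rightarrow> 0\<close>, written so that both sides are the values at \<open>0\<close> of the functions of \<open>\<epsilon>\<close> above.\<close>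
  have "(s * exp (- (2 * 0 / (1 - x\<^sup>2)))) ^ m \<le> exp (0 * C / 2) / sqrt (det K)"
  proof (rule tendsto_le)
    show "((\<lambda>\<epsilon>. exp (\<epsilon> * C / 2) / sqrt (det K)) \<longlongrightarrow> exp (0 * C / 2) / sqrt (det K)) (at_right 0)"
      using detK by (intro tendsto_intros) auto
    show "((\<lambda>\<epsilon>. (s * exp (- (2 * \<epsilon> / (1 - x\<^sup>2)))) ^ m) \<longlongrightarrow> (s * exp (- (2 * 0 / (1 - x\<^sup>2)))) ^ m) (at_right 0)"
      using x2 by (intro tendsto_intros) auto
    show "\<forall>\<^sub>F \<epsilon> in at_right 0. (s * exp (- (2 * \<epsilon> / (1 - x\<^sup>2)))) ^ m \<le> exp (\<epsilon> * C / 2) / sqrt (det K)"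
      using approx by (auto simp: eventually_at_right_less eventually_at_filter)
  qed simp
  then have "s ^ m \<le> 1 / sqrt (det K)" by simp
  then have "(s ^ m)\<^sup>2 \<le> (1 / sqrt (det K))\<^sup>2" using x2 by (intro power_mono) (auto simp: s_def)
  moreover have "(s ^ m)\<^sup>2 = (1 - x\<^sup>2) ^ m"
    using x2 by (simp add: s_def power_mult[symmetric] mult.commute[of m] power_mult)
  moreover have "(1 / sqrt (det K))\<^sup>2 = tau E x"
    using detK MK(4) by (simp add: power_divide field_simps)
  ultimately show ?thesis by (simp add: m_def)
qed

end
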